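(* Let $C(t)$ be a slant null curve in a 3-dimensional Sasaki-like almost contact B-metric manifold $(M,\varphi,\xi,\eta,g)$, with $a=\eta(\dot C)$ (constant) and $b=g(\dot C,\varphi\dot C)$. Then $$\nabla_{\dot C}\dot C=\alpha\,\xi+\beta\,\dot C+\gamma\,\varphi\dot C,$$ where $\alpha,\beta,\gamma$ are the following functions along $C$: $$\alpha=\frac{-b\left(-2(a^4+b^2)+a\dot b\right)}{2(a^4+b^2)},\qquad \beta=\frac{b\dot b}{2(a^4+b^2)},\qquad \gamma=\frac{a\left(-2(a^4+b^2)+a\dot b\right)}{2(a^4+b^2)},$$ and the curvature $k_1$ is given by $$k_1=\epsilon\,\frac{-2(a^4+b^2)+a\dot b}{2\sqrt{a^4+b^2}},\qquad \epsilon=\pm1.$$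
   Context: A 3-dimensional almost contact B-metric manifold $(M,\varphi,\xi,\eta,g)$ is a smooth 3-manifold with an endomorphism $\varphi$ of $TM$, a vector field $\xi$, a 1-form $\eta$ and a pseudo-Riemannian metric $g$ (necessarily of signature $(+,+,-)$) such that $\varphi^2X=-X+\eta(X)\xi$, $\eta(\xi)=1$, $g(\varphi X,\varphi Y)=-g(X,Y)+\eta(X)\eta(Y)$. Consequences: $\eta\circ\varphi=0$, $\varphi\xi=0$, $\eta(X)=g(X,\xi)$. With $\nabla$ the Levi-Civita connection of $g$, it is Sasaki-like if $(\nabla_X\varphi)Y=-g(X,Y)\xi-\eta(Y)X+2\eta(X)\eta(Y)\xi$ (then $\nabla_X\xi=-\varphi X$). A smooth curve $C:I\to M$ ($I$ an interval) is null if $g(\dot C,\dot C)=0$ and $\dot C\neq 0$ on $I$; it is slant if $\eta(\dot C)=a$ is constant. $\dot b=db/dt$. For a slant null curve $a^4+b^2\neq 0$ everywhere. A general Frenet frame along a null curve is $\{\dot C,N,W\}$ with $g(\dot C,N)=g(W,W)=1$, $g(N,N)=g(N,W)=g(\dot C,W)=0$; the curvature $k_1$ is defined by $\nabla_{\dot C}\dot C=h\dot C+k_1W$, and for a given parameter it depends on the frame only up to sign. *)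

theory Defs
  imports "HOL-Analysis.Analysis" "HOL-Library.Function_Algebras"
begin

section \<open>Pointwise real vector space structure on functions\<close>

instantiation "fun" :: (type, real_vector) real_vector
begin

definition scaleR_fun :: "real \<Rightarrow> ('a \<Rightarrow> 'b) \<Rightarrow> 'a \<Rightarrow> 'b"
  where "scaleR_fun r f = (\<lambda>x. r *\<^sub>R f x)"

instance
  by standard (auto simp: scaleR_fun_def fun_eq_iff scaleR_add_right scaleR_add_left)

end

lemma scaleR_fun_apply [simp]: "(r *\<^sub>R f) x = r *\<^sub>R f x"
  by (simp add: scaleR_fun_def)


section \<open>Smooth maps\<close>

text \<open>Maps of class \<open>C\<^sup>k\<close> on an open subset of a Euclidean space (all iterated directional
  derivatives up to order \<open>k\<close> exist and are continuous).\<close>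

primrec Ck_on :: "nat \<Rightarrow> 'a::euclidean_space set \<Rightarrow> ('a \<Rightarrow> 'b::real_normed_vector) \<Rightarrow> bool" where
  "Ck_on 0 S f \<longleftrightarrow> continuous_on S f"
| "Ck_on (Suc k) S f \<longleftrightarrow>
     (\<forall>x\<in>S. f differentiable (at x)) \<and>
     (\<forall>v. Ck_on k S (\<lambda>x. frechet_derivative f (at x) v))"

definition smooth_on :: "'a::euclidean_space set \<Rightarrow> ('a \<Rightarrow> 'b::real_normed_vector) \<Rightarrow> bool"
  where "smooth_on S f \<longleftrightarrow> (\<forall>k. Ck_on k S f)"

text \<open>Functions of one real parameter, for parameter sets \<open>J\<close> that are relatively open in an
  interval.  The derivatives are one-sided at end points of the interval belonging to \<open>J\<close>.\<close>

primrec Ck_param :: "nat \<Rightarrow> real set \<Rightarrow> (real \<Rightarrow> 'b::real_normed_vector) \<Rightarrow> bool" where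
  "Ck_param 0 J f \<longleftrightarrow> continuous_on J f"
| "Ck_param (Suc k) J f \<longleftrightarrow>
     (\<forall>t\<in>J. f differentiable (at t within J)) \<and>
     Ck_param k J (\<lambda>t. vector_derivative f (at t within J))"

definition smooth_param :: "real set \<Rightarrow> (real \<Rightarrow> 'b::real_normed_vector) \<Rightarrow> bool"
  where "smooth_param J f \<longleftrightarrow> (\<forall>k. Ck_param k J f)"


section \<open>Smooth 3-manifolds\<close>

text \<open>A chart is a pair of its domain and its coordinate map (whose values outside the domain
  are irrelevant).\<close>

type_synonym 'm chart = "'m set \<times> ('m \<Rightarrow> real ^ 3)"

definition chart_inv :: "'m chart \<Rightarrow> real ^ 3 \<Rightarrow> 'm"
  where "chart_inv c = inv_into (fst c) (snd c)"

definition transition :: "'m chart \<Rightarrow> 'm chart \<Rightarrow> real ^ 3 \<Rightarrow> real ^ 3"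
  where "transition c d = snd d \<circ> chart_inv c"

definition smooth_3_manifold :: "'m topology \<Rightarrow> 'm chart set \<Rightarrow> bool"
  where "smooth_3_manifold M A \<longleftrightarrow>
    Hausdorff_space M \<and> second_countable M \<and>
    (\<Union>c\<in>A. fst c) = topspace M \<and>
    (\<forall>c\<in>A. openin M (fst c) \<and> open (snd c ` fst c) \<and>
       homeomorphic_map (subtopology M (fst c)) (top_of_set (snd c ` fst c)) (snd c)) \<and>
    (\<forall>c\<in>A. \<forall>d\<in>A. smooth_on (snd c ` (fst c \<inter> fst d)) (transition c d))"


section \<open>Tangent vectors\<close>

text \<open>A tangent vector at \<open>p\<close> is the family of its coordinate triples, one for each chart
  around \<open>p\<close>, related by the Jacobians of the chart transitions.  Families are extended by \<open>0\<close>
  to all other pairs, so that equality of tangent vectors is equality of functions and the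
  tangent spaces are subspaces of a function space.\<close>

type_synonym 'm tvec = "'m chart \<Rightarrow> real ^ 3"

definition at_charts :: "'m chart set \<Rightarrow> 'm \<Rightarrow> 'm tvec \<Rightarrow> 'm tvec"
  where "at_charts A p v = (\<lambda>c. if c \<in> A \<and> p \<in> fst c then v c else 0)"

definition tangent_space :: "'m chart set \<Rightarrow> 'm \<Rightarrow> 'm tvec set"
  where "tangent_space A p = {v. at_charts A p v = v \<and>
    (\<forall>c\<in>A. \<forall>d\<in>A. p \<in> fst c \<longrightarrow> p \<in> fst d \<longrightarrow>
       v d = frechet_derivative (transition c d) (at (snd c p)) (v c))}"

text \<open>The tangent vector at \<open>p\<close> with coordinates \<open>x\<close> in the chart \<open>c\<close>; for \<open>x = axis i 1\<close> this is
  the coordinate vector of the \<open>i\<close>-th coordinate of \<open>c\<close>.\<close>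

definition of_coords :: "'m chart set \<Rightarrow> 'm chart \<Rightarrow> 'm \<Rightarrow> real ^ 3 \<Rightarrow> 'm tvec"
  where "of_coords A c p x =
    at_charts A p (\<lambda>d. frechet_derivative (transition c d) (at (snd c p)) x)"

definition linear_map_on :: "'a::real_vector set \<Rightarrow> ('a \<Rightarrow> 'b::real_vector) \<Rightarrow> bool"
  where "linear_map_on T f \<longleftrightarrow>
    (\<forall>u\<in>T. \<forall>v\<in>T. f (u + v) = f u + f v) \<and> (\<forall>r. \<forall>v\<in>T. f (r *\<^sub>R v) = r *\<^sub>R f v)"


section \<open>Smooth tensor fields\<close>

text \<open>Smoothness of a field means smoothness of its components, as functions of the coordinates,
  in every chart.\<close>

definition smooth_vector_field ::
    "'m topology \<Rightarrow> 'm chart set \<Rightarrow> ('m \<Rightarrow> 'm tvec) \<Rightarrow> bool"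
  where "smooth_vector_field M A X \<longleftrightarrow>
    (\<forall>p\<in>topspace M. X p \<in> tangent_space A p) \<and>
    (\<forall>c\<in>A. smooth_on (snd c ` fst c) (\<lambda>x. X (chart_inv c x) c))"

definition form_comps ::
    "'m chart set \<Rightarrow> ('m \<Rightarrow> 'm tvec \<Rightarrow> real) \<Rightarrow> 'm chart \<Rightarrow> real ^ 3 \<Rightarrow> real ^ 3"
  where "form_comps A \<omega> c x =
    (\<chi> i. \<omega> (chart_inv c x) (of_coords A c (chart_inv c x) (axis i 1)))"

definition smooth_1_form ::
    "'m topology \<Rightarrow> 'm chart set \<Rightarrow> ('m \<Rightarrow> 'm tvec \<Rightarrow> real) \<Rightarrow> bool"
  where "smooth_1_form M A \<omega> \<longleftrightarrow>
    (\<forall>p\<in>topspace M. linear_map_on (tangent_space A p) (\<omega> p)) \<and>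
    (\<forall>c\<in>A. smooth_on (snd c ` fst c) (form_comps A \<omega> c))"

definition endo_comps ::
    "'m chart set \<Rightarrow> ('m \<Rightarrow> 'm tvec \<Rightarrow> 'm tvec) \<Rightarrow> 'm chart \<Rightarrow> real ^ 3 \<Rightarrow> real ^ 3 ^ 3"
  where "endo_comps A \<phi> c x =
    (\<chi> i j. \<phi> (chart_inv c x) (of_coords A c (chart_inv c x) (axis j 1)) c $ i)"

definition smooth_endomorphism ::
    "'m topology \<Rightarrow> 'm chart set \<Rightarrow> ('m \<Rightarrow> 'm tvec \<Rightarrow> 'm tvec) \<Rightarrow> bool"
  where "smooth_endomorphism M A \<phi> \<longleftrightarrow>
    (\<forall>p\<in>topspace M. \<phi> p ` tangent_space A p \<subseteq> tangent_space A p \<and>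
       linear_map_on (tangent_space A p) (\<phi> p)) \<and>
    (\<forall>c\<in>A. smooth_on (snd c ` fst c) (endo_comps A \<phi> c))"

definition metric_comps ::
    "'m chart set \<Rightarrow> ('m \<Rightarrow> 'm tvec \<Rightarrow> 'm tvec \<Rightarrow> real) \<Rightarrow> 'm chart \<Rightarrow> real ^ 3 \<Rightarrow> real ^ 3 ^ 3"
  where "metric_comps A g c x =
    (\<chi> i j. g (chart_inv c x) (of_coords A c (chart_inv c x) (axis i 1))
                              (of_coords A c (chart_inv c x) (axis j 1)))"

definition pseudo_riemannian_metric ::
    "'m topology \<Rightarrow> 'm chart set \<Rightarrow> ('m \<Rightarrow> 'm tvec \<Rightarrow> 'm tvec \<Rightarrow> real) \<Rightarrow> bool"
  where "pseudo_riemannian_metric M A g \<longleftrightarrow>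
    (\<forall>p\<in>topspace M.
       (\<forall>u\<in>tangent_space A p. linear_map_on (tangent_space A p) (g p u)) \<and>
       (\<forall>u\<in>tangent_space A p. \<forall>v\<in>tangent_space A p. g p u v = g p v u) \<and>
       (\<forall>u\<in>tangent_space A p. (\<forall>v\<in>tangent_space A p. g p u v = 0) \<longrightarrow> u = 0)) \<and>
    (\<forall>c\<in>A. smooth_on (snd c ` fst c) (metric_comps A g c))"


section \<open>The Levi-Civita connection\<close>

text \<open>Christoffel symbols
  \<open>\<Gamma>\<^sup>k\<^sub>i\<^sub>j = 1/2 g\<^sup>k\<^sup>l (\<partial>\<^sub>i g\<^sub>j\<^sub>l + \<partial>\<^sub>j g\<^sub>i\<^sub>l - \<partial>\<^sub>l g\<^sub>i\<^sub>j)\<close> in the chart \<open>c\<close>.\<close>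

definition christoffel ::
    "'m chart set \<Rightarrow> ('m \<Rightarrow> 'm tvec \<Rightarrow> 'm tvec \<Rightarrow> real) \<Rightarrow> 'm chart \<Rightarrow> real ^ 3 \<Rightarrow> 3 \<Rightarrow> 3 \<Rightarrow> 3 \<Rightarrow> real"
  where "christoffel A g c x k i j =
    (let dg = (\<lambda>l. frechet_derivative (metric_comps A g c) (at x) (axis l 1))
     in 1/2 * (\<Sum>l\<in>UNIV. matrix_inv (metric_comps A g c x) $ k $ l *
                          (dg i $ j $ l + dg j $ i $ l - dg l $ i $ j)))"

definition christoffel_map ::
    "'m chart set \<Rightarrow> ('m \<Rightarrow> 'm tvec \<Rightarrow> 'm tvec \<Rightarrow> real) \<Rightarrow> 'm chart \<Rightarrow> real ^ 3 \<Rightarrow>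
      real ^ 3 \<Rightarrow> real ^ 3 \<Rightarrow> real ^ 3"
  where "christoffel_map A g c x u v =
    (\<chi> k. \<Sum>i\<in>UNIV. \<Sum>j\<in>UNIV. christoffel A g c x k i j * u $ i * v $ j)"

text \<open>The tangent vector \<open>(\<nabla>\<^sub>X \<phi>) Y\<close> for \<open>X\<close>, \<open>Y\<close> tangent at \<open>p\<close>.  In the chart \<open>c\<close> the
  covariant derivative of the \<open>(1,1)\<close>-tensor \<open>\<phi>\<close> has the components
  \<open>\<nabla>\<^sub>k \<phi>\<^sup>i\<^sub>j = \<partial>\<^sub>k \<phi>\<^sup>i\<^sub>j + \<Gamma>\<^sup>i\<^sub>k\<^sub>m \<phi>\<^sup>m\<^sub>j - \<phi>\<^sup>i\<^sub>m \<Gamma>\<^sup>m\<^sub>k\<^sub>j\<close>; equivalently this is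
  \<open>\<nabla>\<^sub>X (\<phi> Y) - \<phi> (\<nabla>\<^sub>X Y)\<close>, with \<open>Y\<close> extended by constant components in \<open>c\<close>.\<close>

definition nabla_endo ::
    "'m chart set \<Rightarrow> ('m \<Rightarrow> 'm tvec \<Rightarrow> 'm tvec \<Rightarrow> real) \<Rightarrow> ('m \<Rightarrow> 'm tvec \<Rightarrow> 'm tvec) \<Rightarrow>
      'm \<Rightarrow> 'm tvec \<Rightarrow> 'm tvec \<Rightarrow> 'm tvec"
  where "nabla_endo A g \<phi> p X Y = at_charts A p (\<lambda>c.
    let x = snd c p; F = endo_comps A \<phi> c in
      frechet_derivative F (at x) (X c) *v Y c
      + christoffel_map A g c x (X c) (F x *v Y c)
      - F x *v christoffel_map A g c x (X c) (Y c))"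


section \<open>Sasaki-like almost contact B-metric manifolds\<close>

definition almost_contact_B_metric_3_manifold ::
    "'m topology \<Rightarrow> 'm chart set \<Rightarrow> ('m \<Rightarrow> 'm tvec \<Rightarrow> 'm tvec) \<Rightarrow> ('m \<Rightarrow> 'm tvec) \<Rightarrow>
      ('m \<Rightarrow> 'm tvec \<Rightarrow> real) \<Rightarrow> ('m \<Rightarrow> 'm tvec \<Rightarrow> 'm tvec \<Rightarrow> real) \<Rightarrow> bool"
  where "almost_contact_B_metric_3_manifold M A \<phi> \<xi> \<eta> g \<longleftrightarrow>
    smooth_3_manifold M A \<and>
    smooth_endomorphism M A \<phi> \<and> smooth_vector_field M A \<xi> \<and>
    smooth_1_form M A \<eta> \<and> pseudo_riemannian_metric M A g \<and>
    (\<forall>p\<in>topspace M.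
       \<eta> p (\<xi> p) = 1 \<and>
       (\<forall>X\<in>tangent_space A p. \<phi> p (\<phi> p X) = - X + \<eta> p X *\<^sub>R \<xi> p) \<and>
       (\<forall>X\<in>tangent_space A p. \<forall>Y\<in>tangent_space A p.
          g p (\<phi> p X) (\<phi> p Y) = - g p X Y + \<eta> p X * \<eta> p Y))"

definition sasaki_like ::
    "'m topology \<Rightarrow> 'm chart set \<Rightarrow> ('m \<Rightarrow> 'm tvec \<Rightarrow> 'm tvec) \<Rightarrow> ('m \<Rightarrow> 'm tvec) \<Rightarrow>
      ('m \<Rightarrow> 'm tvec \<Rightarrow> real) \<Rightarrow> ('m \<Rightarrow> 'm tvec \<Rightarrow> 'm tvec \<Rightarrow> real) \<Rightarrow> bool"
  where "sasaki_like M A \<phi> \<xi> \<eta> g \<longleftrightarrow>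
    (\<forall>p\<in>topspace M. \<forall>X\<in>tangent_space A p. \<forall>Y\<in>tangent_space A p.
       nabla_endo A g \<phi> p X Y =
         - (g p X Y *\<^sub>R \<xi> p) - \<eta> p Y *\<^sub>R X + (2 * \<eta> p X * \<eta> p Y) *\<^sub>R \<xi> p)"


section \<open>Curves\<close>

definition smooth_curve ::
    "'m topology \<Rightarrow> 'm chart set \<Rightarrow> real set \<Rightarrow> (real \<Rightarrow> 'm) \<Rightarrow> bool"
  where "smooth_curve M A I C \<longleftrightarrow>
    is_interval I \<and> interior I \<noteq> {} \<and> continuous_map (top_of_set I) M C \<and>
    (\<forall>c\<in>A. smooth_param {t\<in>I. C t \<in> fst c} (\<lambda>t. snd c (C t)))"

definition velocity ::
    "'m chart set \<Rightarrow> real set \<Rightarrow> (real \<Rightarrow> 'm) \<Rightarrow> real \<Rightarrow> 'm tvec"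
  where "velocity A I C t =
    at_charts A (C t) (\<lambda>c. vector_derivative (\<lambda>s. snd c (C s)) (at t within I))"

definition smooth_field_along ::
    "'m chart set \<Rightarrow> real set \<Rightarrow> (real \<Rightarrow> 'm) \<Rightarrow> (real \<Rightarrow> 'm tvec) \<Rightarrow> bool"
  where "smooth_field_along A I C V \<longleftrightarrow>
    (\<forall>t\<in>I. V t \<in> tangent_space A (C t)) \<and>
    (\<forall>c\<in>A. smooth_param {t\<in>I. C t \<in> fst c} (\<lambda>t. V t c))"

text \<open>The covariant derivative of a vector field \<open>V\<close> along \<open>C\<close> for the Levi-Civita connection of
  \<open>g\<close>, with components \<open>dV\<^sup>k/dt + \<Gamma>\<^sup>k\<^sub>i\<^sub>j (dC\<^sup>i/dt) V\<^sup>j\<close>.\<close>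

definition nabla_along ::
    "'m chart set \<Rightarrow> ('m \<Rightarrow> 'm tvec \<Rightarrow> 'm tvec \<Rightarrow> real) \<Rightarrow> real set \<Rightarrow> (real \<Rightarrow> 'm) \<Rightarrow>
      (real \<Rightarrow> 'm tvec) \<Rightarrow> real \<Rightarrow> 'm tvec"
  where "nabla_along A g I C V t = at_charts A (C t) (\<lambda>c.
    vector_derivative (\<lambda>s. V s c) (at t within I)
    + christoffel_map A g c (snd c (C t)) (velocity A I C t c) (V t c))"

definition null_curve ::
    "'m topology \<Rightarrow> 'm chart set \<Rightarrow> ('m \<Rightarrow> 'm tvec \<Rightarrow> 'm tvec \<Rightarrow> real) \<Rightarrow> real set \<Rightarrow>
      (real \<Rightarrow> 'm) \<Rightarrow> bool"
  where "null_curve M A g I C \<longleftrightarrow> smooth_curve M A I C \<and>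
    (\<forall>t\<in>I. g (C t) (velocity A I C t) (velocity A I C t) = 0 \<and> velocity A I C t \<noteq> 0)"

definition slant ::
    "'m chart set \<Rightarrow> ('m \<Rightarrow> 'm tvec \<Rightarrow> real) \<Rightarrow> real set \<Rightarrow> (real \<Rightarrow> 'm) \<Rightarrow> real \<Rightarrow> bool"
  where "slant A \<eta> I C a \<longleftrightarrow> (\<forall>t\<in>I. \<eta> (C t) (velocity A I C t) = a)"

definition frenet_frame ::
    "'m chart set \<Rightarrow> ('m \<Rightarrow> 'm tvec \<Rightarrow> 'm tvec \<Rightarrow> real) \<Rightarrow> real set \<Rightarrow> (real \<Rightarrow> 'm) \<Rightarrow>
      (real \<Rightarrow> 'm tvec) \<Rightarrow> (real \<Rightarrow> 'm tvec) \<Rightarrow> bool"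
  where "frenet_frame A g I C N W \<longleftrightarrow>
    smooth_field_along A I C N \<and> smooth_field_along A I C W \<and>
    (\<forall>t\<in>I. g (C t) (velocity A I C t) (N t) = 1 \<and> g (C t) (W t) (W t) = 1 \<and>
           g (C t) (N t) (N t) = 0 \<and> g (C t) (N t) (W t) = 0 \<and>
           g (C t) (velocity A I C t) (W t) = 0)"

definition frenet_k1 ::
    "'m chart set \<Rightarrow> ('m \<Rightarrow> 'm tvec \<Rightarrow> 'm tvec \<Rightarrow> real) \<Rightarrow> real set \<Rightarrow> (real \<Rightarrow> 'm) \<Rightarrow>
      (real \<Rightarrow> 'm tvec) \<Rightarrow> real \<Rightarrow> real"
  where "frenet_k1 A g I C W t =
    (THE k. \<exists>h. nabla_along A g I C (velocity A I C) t = h *\<^sub>R velocity A I C t + k *\<^sub>R W t)"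

end

theory Submission
  imports Defs
begin

text \<open>
  Let \<open>V\<close> be the velocity of the curve and \<open>D = a\<^sup>4 + b\<^sup>2\<close>.  The acceleration \<open>\<nabla>V\<close> is a vector in a
  three-dimensional space with a nondegenerate metric, so it is determined by its products with the frame
  \<open>\<xi>\<close>, \<open>V\<close>, \<open>\<phi> V\<close>.  These are linearly independent for every null vector \<open>V \<noteq> 0\<close>
  (\<open>combination_eq_0D\<close>), and the determinant \<open>- D\<close> of their Gram matrix is nonzero
  (\<open>null_vector_discriminant_pos\<close>).

  The three products come from differentiating the scalar functions of the curve.  The nullity \<open>g(V, V) = 0\<close>
  gives \<open>g(\<nabla>V, V) = 0\<close>.  The slant condition \<open>g(\<xi>, V) = a\<close> together with \<open>\<nabla>\<xi> = - \<phi> V\<close> gives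
  \<open>g(\<nabla>V, \<xi>) = b\<close> (\<open>acceleration_\<xi>\<close>).  Finally the derivative of \<open>b = g(V, \<phi> V)\<close>, with
  \<open>\<nabla>(\<phi> V) = \<phi> (\<nabla>V) - a V + 2 a\<^sup>2 \<xi>\<close> and the self-adjointness of \<open>\<phi>\<close>, is \<open>2 g(\<nabla>V, \<phi> V) + 2 a\<^sup>3\<close>
  (\<open>b_has_derivative\<close>).  Solving the Gram system yields the formula for \<open>\<nabla>V\<close>
  (\<open>vector_determined_by_frame_products\<close>).

  Writing \<open>b'\<close> for the derivative of \<open>b\<close>, the formula says \<open>\<nabla>V = \<beta> V + K E\<close> with
  \<open>E = - b \<xi> + a \<phi> V\<close> and \<open>K = (- 2 D + a b') / (2 D)\<close>.  The vector \<open>E\<close>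
  is orthogonal to \<open>V\<close> and has square \<open>D\<close>, and \<open>V\<close>, \<open>E\<close> span the orthogonal complement of \<open>V\<close>.  Hence the
  vector \<open>W\<close> of a Frenet frame is \<open>\<plusminus> E / sqrt D\<close> up to a multiple of \<open>V\<close>, and \<open>k\<^sub>1 = \<plusminus> K sqrt D\<close>.  The sign
  is a continuous function of the parameter, hence constant.

  All differentiation takes place in one chart at a time.  It rests on two product rules,
  \<open>metric_derivative_along\<close>, which comes from the compatibility of the Christoffel symbols with the metric
  (\<open>christoffel_map_metric\<close>), and \<open>endomorphism_derivative_along\<close>.
\<close>

section \<open>Linear algebra of almost contact B-metric spaces\<close>

text \<open>The structure that an almost contact B-metric manifold induces on one tangent space, read in the
  coordinates of a chart.\<close>
locale almost_contact_B_space =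
  fixes f :: "real ^ 3 \<Rightarrow> real ^ 3" and \<xi> :: "real ^ 3"
    and \<eta> :: "real ^ 3 \<Rightarrow> real" and g :: "real ^ 3 \<Rightarrow> real ^ 3 \<Rightarrow> real"
  assumes linear_f: "linear f" and linear_\<eta>: "linear \<eta>" and bilinear_g: "bilinear g"
    and g_sym: "g x y = g y x"
    and g_nondegenerate: "(\<And>y. g x y = 0) \<Longrightarrow> x = 0"
    and \<eta>_\<xi> [simp]: "\<eta> \<xi> = 1"
    and f_f: "f (f x) = - x + \<eta> x *\<^sub>R \<xi>"
    and g_f_f: "g (f x) (f y) = - g x y + \<eta> x * \<eta> y"
begin

lemmas g_linear = bilinear_ladd[OF bilinear_g] bilinear_radd[OF bilinear_g]
  bilinear_lmul[OF bilinear_g] bilinear_rmul[OF bilinear_g]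
  bilinear_lneg[OF bilinear_g] bilinear_rneg[OF bilinear_g]
  bilinear_lsub[OF bilinear_g] bilinear_rsub[OF bilinear_g]
  bilinear_lzero[OF bilinear_g] bilinear_rzero[OF bilinear_g]

lemmas f_linear = linear_add[OF linear_f] linear_scale[OF linear_f] linear_neg[OF linear_f]
  linear_diff[OF linear_f] linear_0[OF linear_f]

lemmas \<eta>_linear = linear_add[OF linear_\<eta>] linear_scale[OF linear_\<eta>] linear_neg[OF linear_\<eta>]
  linear_diff[OF linear_\<eta>] linear_0[OF linear_\<eta>]

text \<open>Computing \<open>f\<^sup>3\<close> in two ways shows that \<open>f \<xi>\<close> is a multiple of \<open>\<xi>\<close>; as \<open>f\<^sup>2 \<xi> = 0\<close>, the
  factor is nilpotent.\<close>
lemma f_\<xi> [simp]: "f \<xi> = 0"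
proof -
  have f_f_\<xi>: "f (f \<xi>) = 0" by (simp add: f_f)
  then have "f \<xi> = \<eta> (f \<xi>) *\<^sub>R \<xi>"
    using f_f[of "f \<xi>"] by (simp add: f_linear)
  then have "f (f \<xi>) = (\<eta> (f \<xi>) * \<eta> (f \<xi>)) *\<^sub>R \<xi>" by (metis f_linear(2) scaleR_scaleR)
  then have "\<eta> (f \<xi>) * \<eta> (f \<xi>) = 0"
    using f_f_\<xi> \<eta>_\<xi> \<eta>_linear(5) by (metis scaleR_eq_0_iff zero_neq_one)
  with \<open>f \<xi> = \<eta> (f \<xi>) *\<^sub>R \<xi>\<close> show ?thesis by simp
qed

lemma \<eta>_f [simp]: "\<eta> (f x) = 0"
proof -
  have "- f x + \<eta> (f x) *\<^sub>R \<xi> = f (f (f x))" by (rule f_f[symmetric])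
  also have "\<dots> = - f x" by (subst f_f) (simp add: f_linear)
  finally have "\<eta> (f x) *\<^sub>R \<xi> = 0" by simp
  then show ?thesis using \<eta>_\<xi> \<eta>_linear(5) by (metis scaleR_eq_0_iff zero_neq_one)
qed

lemma g_\<xi>: "g \<xi> x = \<eta> x"
  using g_f_f[of \<xi> x] by (simp add: g_linear)

lemma g_\<xi>_right: "g x \<xi> = \<eta> x"
  by (metis g_sym g_\<xi>)

lemma g_f_left: "g (f x) y = g x (f y)"
  using g_f_f[of "f x" y] by (simp add: f_f g_linear g_\<xi>)

text \<open>A null vector \<open>v \<noteq> 0\<close> is no multiple of \<open>\<xi>\<close>, because \<open>g \<xi> \<xi> = 1\<close>.  Its component \<open>u \<noteq> 0\<close> in the
  kernel of \<open>\<eta>\<close> is linearly independent of \<open>f u\<close>, because \<open>f\<close> is a complex structure on that kernel;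
  this makes \<open>\<xi>\<close>, \<open>v\<close> and \<open>f v\<close> linearly independent.\<close>
lemma combination_eq_0D:
  assumes v: "v \<noteq> 0" "g v v = 0" and eq: "p *\<^sub>R \<xi> + q *\<^sub>R v + r *\<^sub>R f v = 0"
  shows "p = 0 \<and> q = 0 \<and> r = 0"
proof -
  define u where "u = v - \<eta> v *\<^sub>R \<xi>"
  have fu: "f v = f u" and \<eta>u: "\<eta> u = 0" by (simp_all add: u_def f_linear \<eta>_linear)
  have "u \<noteq> 0"
  proof
    assume "u = 0"
    then have "v = \<eta> v *\<^sub>R \<xi>" by (simp add: u_def)
    then have "\<eta> v * \<eta> v = g v v" by (metis bilinear_lmul[OF bilinear_g] g_\<xi> real_scaleR_def)
    with v have "\<eta> v = 0" by simp
    with \<open>v = \<eta> v *\<^sub>R \<xi>\<close> v(1) show False by simp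
  qed
  have \<eta>0: "p + q * \<eta> v = 0" using arg_cong[OF eq, of \<eta>] by (simp add: \<eta>_linear)
  have 1: "q *\<^sub>R f u - r *\<^sub>R u = 0"
    using arg_cong[OF eq, of f] by (simp add: f_linear fu f_f \<eta>u)
  have 2: "- q *\<^sub>R u - r *\<^sub>R f u = 0"
    using arg_cong[OF 1, of f] by (simp add: f_linear f_f \<eta>u)
  \<comment> \<open>By the first equation \<open>q f - r\<close> annihilates \<open>u\<close>; applying the conjugate \<open>- q f - r\<close> gives a real multiple of \<open>u\<close>.\<close>
  have "(q * q + r * r) *\<^sub>R u = - (q *\<^sub>R (- q *\<^sub>R u - r *\<^sub>R f u) + r *\<^sub>R (q *\<^sub>R f u - r *\<^sub>R u))"
    by (simp add: algebra_simps)
  also have "\<dots> = 0" using 1 2 by simp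
  finally have "q * q + r * r = 0" using \<open>u \<noteq> 0\<close> by simp
  then have "q = 0" "r = 0" by (simp_all add: sum_squares_eq_zero_iff)
  with \<eta>0 show ?thesis by simp
qed

text \<open>The dimension enters here: three linearly independent vectors span the space.\<close>
lemma null_vector_frame_spans:
  assumes v: "v \<noteq> 0" "g v v = 0"
  obtains p q r where "w = p *\<^sub>R \<xi> + q *\<^sub>R v + r *\<^sub>R f v"
proof -
  define K where "K = (\<lambda>c::real^3. (c $ 1) *\<^sub>R \<xi> + (c $ 2) *\<^sub>R v + (c $ 3) *\<^sub>R f v)"
  have lin: "linear K"
    by (rule linearI) (simp_all add: K_def algebra_simps)
  have "c = 0" if "K c = 0" for c
    using combination_eq_0D[OF v that[unfolded K_def]] by (simp add: vec_eq_iff forall_3)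
  then have "inj K" using linear_injective_0[OF lin] by blast
  then have "surj K" by (rule linear_injective_imp_surjective[OF lin]) simp
  then obtain c where "w = K c" by (metis surjD)
  then show ?thesis using that by (simp add: K_def)
qed

lemma eq_0_if_orthogonal_to_frame:
  assumes v: "v \<noteq> 0" "g v v = 0"
    and "g z \<xi> = 0" "g z v = 0" "g z (f v) = 0"
  shows "z = 0"
proof (rule g_nondegenerate)
  fix w
  obtain p q r where "w = p *\<^sub>R \<xi> + q *\<^sub>R v + r *\<^sub>R f v"
    using null_vector_frame_spans[OF v] by blast
  with assms show "g z w = 0" by (simp add: g_linear)
qed

text \<open>\<open>- ((\<eta> v)\<^sup>4 + (g v (f v))\<^sup>2)\<close> is the Gram determinant of \<open>\<xi>\<close>, \<open>v\<close>, \<open>f v\<close>.  If both terms vanished,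
  \<open>v\<close> would be orthogonal to the whole frame.\<close>
lemma null_vector_discriminant_pos:
  assumes v: "v \<noteq> 0" "g v v = 0"
  shows "(\<eta> v) ^ 4 + (g v (f v))\<^sup>2 > 0"
proof (rule ccontr)
  assume "\<not> ?thesis"
  moreover have "(\<eta> v) ^ 4 \<ge> 0" "(g v (f v))\<^sup>2 \<ge> 0" by simp_all
  ultimately have "(\<eta> v) ^ 4 = 0" "(g v (f v))\<^sup>2 = 0" by linarith+
  then have "\<eta> v = 0" "g v (f v) = 0" by simp_all
  then have "g v \<xi> = 0" by (simp add: g_\<xi>_right)
  then have "v = 0"
    using eq_0_if_orthogonal_to_frame[OF v] \<open>g v (f v) = 0\<close> v(2) by blast
  with v show False by simp
qed

lemma null_frame_products:
  assumes "g v v = 0"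
  shows "g \<xi> (f v) = 0" "g (f v) \<xi> = 0" "g v \<xi> = \<eta> v" "g \<xi> v = \<eta> v" "g \<xi> \<xi> = 1"
    "g (f v) v = g v (f v)" "g (f v) (f v) = (\<eta> v)\<^sup>2"
  using assms by (simp_all add: g_\<xi> g_\<xi>_right g_f_left f_f g_linear power2_eq_square)

text \<open>A vector is determined by its products with the frame \<open>\<xi>\<close>, \<open>v\<close>, \<open>f v\<close>.  The products prescribed here are
  those of the acceleration of a slant null curve with velocity \<open>v\<close>, where \<open>b'\<close> is the derivative of \<open>b\<close>; the
  coefficients solve the resulting Gram system.\<close>
lemma vector_determined_by_frame_products:
  assumes v: "v \<noteq> 0" "g v v = 0"
    and a: "a = \<eta> v" and b: "b = g v (f v)" and D: "D = a ^ 4 + b\<^sup>2"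
    and z: "g z v = 0" "g z \<xi> = b" "g z (f v) = b' / 2 - a ^ 3"
  shows "z = (- b * (- 2 * D + a * b') / (2 * D)) *\<^sub>R \<xi> + (b * b' / (2 * D)) *\<^sub>R v
           + (a * (- 2 * D + a * b') / (2 * D)) *\<^sub>R f v"
    (is "z = ?p *\<^sub>R \<xi> + ?q *\<^sub>R v + ?r *\<^sub>R f v")
proof -
  have D0: "D \<noteq> 0" using null_vector_discriminant_pos[OF v] by (simp add: D a b)
  note fv = null_frame_products[OF v(2), folded a b]
  have 1: "?p + ?q * a = b"
  proof -
    have "?p + ?q * a = (- b * (- 2 * D + a * b') + b * b' * a) / (2 * D)"
      by (simp only: add_divide_distrib times_divide_eq_left)
    also have "- b * (- 2 * D + a * b') + b * b' * a = b * (2 * D)" by (simp add: algebra_simps)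
    finally show ?thesis using D0 by simp
  qed
  have 2: "?p * a + ?r * b = 0"
  proof -
    have "?p * a + ?r * b = (- b * (- 2 * D + a * b') * a + a * (- 2 * D + a * b') * b) / (2 * D)"
      by (simp only: add_divide_distrib times_divide_eq_left)
    also have "- b * (- 2 * D + a * b') * a + a * (- 2 * D + a * b') * b = 0" by (simp add: algebra_simps)
    finally show ?thesis by simp
  qed
  have 3: "?q * b + ?r * a\<^sup>2 = b' / 2 - a ^ 3"
  proof -
    have "?q * b + ?r * a\<^sup>2 = (b * b' * b + a * (- 2 * D + a * b') * a\<^sup>2) / (2 * D)"
      by (simp only: add_divide_distrib times_divide_eq_left)
    also have "b * b' * b + a * (- 2 * D + a * b') * a\<^sup>2 = b' * (a ^ 4 + b\<^sup>2) - 2 * a ^ 3 * D"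
      by (simp add: algebra_simps power2_eq_square power3_eq_cube power4_eq_xxxx)
    also have "\<dots> = (b' / 2 - a ^ 3) * (2 * D)"
      by (simp only: D[symmetric]) (simp add: algebra_simps)
    finally show ?thesis using D0 by simp
  qed
  obtain P Q R where PQR: "P = ?p" "Q = ?q" "R = ?r" by simp
  have "z - (P *\<^sub>R \<xi> + Q *\<^sub>R v + R *\<^sub>R f v) = 0"
  proof (rule eq_0_if_orthogonal_to_frame[OF v])
    show "g (z - (P *\<^sub>R \<xi> + Q *\<^sub>R v + R *\<^sub>R f v)) \<xi> = 0"
      using 1[folded PQR] by (simp add: g_linear fv z)
    show "g (z - (P *\<^sub>R \<xi> + Q *\<^sub>R v + R *\<^sub>R f v)) v = 0"
      using 2[folded PQR] by (simp add: g_linear fv z v)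
    show "g (z - (P *\<^sub>R \<xi> + Q *\<^sub>R v + R *\<^sub>R f v)) (f v) = 0"
      using 3[folded PQR] by (simp add: g_linear fv b[symmetric] z)
  qed
  then have "z = P *\<^sub>R \<xi> + Q *\<^sub>R v + R *\<^sub>R f v" by simp
  then show ?thesis unfolding PQR .
qed

text \<open>The plane orthogonal to the null vector \<open>v\<close> is spanned by \<open>v\<close> and by the vector
  \<open>- b \<xi> + a f v\<close> of square \<open>D\<close>, so a unit vector in it has, up to sign, the component
  \<open>1 / sqrt D\<close> along the latter.\<close>
lemma unit_normal_of_null_vector:
  assumes v: "v \<noteq> 0" "g v v = 0"
    and a: "a = \<eta> v" and b: "b = g v (f v)" and D: "D = a ^ 4 + b\<^sup>2"
    and w: "g v w = 0" "g w w = 1"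
    and m: "m = (- b * g w \<xi> + a * g w (f v)) / D"
  shows "m\<^sup>2 * D = 1" "\<exists>q. w = m *\<^sub>R (- b *\<^sub>R \<xi> + a *\<^sub>R f v) + q *\<^sub>R v"
proof -
  have Dpos: "D > 0" using null_vector_discriminant_pos[OF v] by (simp add: D a b)
  note fv = null_frame_products[OF v(2), folded a b]
  define E where "E = - b *\<^sub>R \<xi> + a *\<^sub>R f v"
  have gEE: "g E E = D"
    by (simp add: E_def g_linear fv b[symmetric] D algebra_simps power2_eq_square power4_eq_xxxx)
  have gvE: "g v E = 0" "g E v = 0" by (simp_all add: E_def g_linear fv b[symmetric])
  have mE: "m = g w E / D" by (simp add: m E_def g_linear)
  obtain p q r where w_eq: "w = p *\<^sub>R \<xi> + q *\<^sub>R v + r *\<^sub>R f v"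
    using null_vector_frame_spans[OF v] by blast
  have pr: "a * p + b * r = 0" using w(1) v(2) by (simp add: w_eq g_linear fv b[symmetric] mult.commute)
  have "a\<^sup>2 + b\<^sup>2 \<noteq> 0"
    using Dpos D by (auto simp: sum_power2_eq_zero_iff)
  define n where "n = (a * r - b * p) / (a\<^sup>2 + b\<^sup>2)"
  have "- b * n = p"
  proof -
    have "- b * (a * r - b * p) - p * (a\<^sup>2 + b\<^sup>2) = - a * (a * p + b * r)"
      by (simp add: algebra_simps power2_eq_square)
    then show ?thesis using pr \<open>a\<^sup>2 + b\<^sup>2 \<noteq> 0\<close> by (simp add: n_def field_simps)
  qed
  moreover have "a * n = r"
  proof -
    have "a * (a * r - b * p) - r * (a\<^sup>2 + b\<^sup>2) = - b * (a * p + b * r)"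
      by (simp add: algebra_simps power2_eq_square)
    then show ?thesis using pr \<open>a\<^sup>2 + b\<^sup>2 \<noteq> 0\<close> by (simp add: n_def field_simps)
  qed
  ultimately have "p = - (b * n)" "r = a * n" by simp_all
  then have "w = n *\<^sub>R E + q *\<^sub>R v"
    unfolding w_eq E_def by (simp add: scaleR_diff_right mult.commute)
  then have "g w E = n * D" "g w w = n * n * D"
    by (simp_all add: g_linear gEE gvE v)
  then have "m = n" "n\<^sup>2 * D = 1" using Dpos w(2) mE by (simp_all add: power2_eq_square)
  then show "m\<^sup>2 * D = 1" by simp
  show "\<exists>q. w = m *\<^sub>R (- b *\<^sub>R \<xi> + a *\<^sub>R f v) + q *\<^sub>R v"
    using \<open>w = n *\<^sub>R E + q *\<^sub>R v\<close> \<open>m = n\<close> unfolding E_def by blast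
qed

end

section \<open>Metric compatibility of the Christoffel symbols\<close>
lemma inner_matrix_vector_symmetric:
  fixes G :: "real ^ 'n ^ 'n"
  assumes "transpose G = G"
  shows "u \<bullet> (G *v w) = w \<bullet> (G *v u)"
  by (metis assms dot_lmul_matrix inner_commute transpose_matrix_vector)

lemma matrix_mult_matrix_inv:
  fixes G :: "real ^ 'n ^ 'n"
  assumes "invertible G"
  shows "G ** matrix_inv G = mat 1"
  using assms unfolding invertible_def matrix_inv_def by (rule someI2_ex) blast

text \<open>Lowering the upper index of the Christoffel symbols removes the inverse metric.\<close>
lemma matrix_mult_christoffel_map:
  assumes "invertible (metric_comps A g c x)"
  shows "(metric_comps A g c x *v christoffel_map A g c x u v) =
    (\<Sum>i\<in>UNIV. \<Sum>j\<in>UNIV. (u $ i * v $ j / 2) *\<^sub>R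
      (\<chi> l. frechet_derivative (metric_comps A g c) (at x) (axis i 1) $ j $ l
           + frechet_derivative (metric_comps A g c) (at x) (axis j 1) $ i $ l
           - frechet_derivative (metric_comps A g c) (at x) (axis l 1) $ i $ j))"
proof -
  let ?G = "metric_comps A g c x"
  define L where "L = (\<lambda>i j. \<chi> l. frechet_derivative (metric_comps A g c) (at x) (axis i 1) $ j $ l
           + frechet_derivative (metric_comps A g c) (at x) (axis j 1) $ i $ l
           - frechet_derivative (metric_comps A g c) (at x) (axis l 1) $ i $ j)"
  have chr: "christoffel A g c x k i j = (1/2) * (matrix_inv ?G *v L i j) $ k" for k i j
    by (simp add: christoffel_def Let_def L_def matrix_vector_mult_def)
  have "christoffel_map A g c x u v =
      (\<Sum>i\<in>UNIV. \<Sum>j\<in>UNIV. (u $ i * v $ j / 2) *\<^sub>R (matrix_inv ?G *v L i j))"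
    by (simp add: christoffel_map_def chr vec_eq_iff mult_ac)
  then have "?G *v christoffel_map A g c x u v =
      (\<Sum>i\<in>UNIV. \<Sum>j\<in>UNIV. (u $ i * v $ j / 2) *\<^sub>R ((?G ** matrix_inv ?G) *v L i j))"
    by (simp add: linear_sum[OF matrix_vector_mul_linear] matrix_vector_mult_scaleR
        matrix_vector_mul_assoc)
  then show ?thesis by (simp add: matrix_mult_matrix_inv[OF assms] L_def)
qed

text \<open>The Levi-Civita connection is metric.  The derivatives of the metric in
  \<open>\<Gamma>\<^sub>m\<^sub>i\<^sub>j + \<Gamma>\<^sub>j\<^sub>i\<^sub>m\<close> cancel except for the two equal terms
  \<open>\<partial>\<^sub>i g\<^sub>j\<^sub>m\<close>.\<close>
lemma christoffel_map_metric:
  assumes inv: "invertible (metric_comps A g c x)"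
    and diff: "metric_comps A g c differentiable (at x)"
    and S: "open S" "x \<in> S" and sym: "\<And>y. y \<in> S \<Longrightarrow> transpose (metric_comps A g c y) = metric_comps A g c y"
  shows "christoffel_map A g c x u v \<bullet> (metric_comps A g c x *v w)
       + v \<bullet> (metric_comps A g c x *v christoffel_map A g c x u w)
       = v \<bullet> (frechet_derivative (metric_comps A g c) (at x) u *v w)"
proof -
  let ?G = "metric_comps A g c"
  define dG where "dG = frechet_derivative ?G (at x)"
  have dG: "(?G has_derivative dG) (at x)"
    using diff by (simp add: dG_def flip: frechet_derivative_works)
  then have lin: "linear dG" by (rule has_derivative_linear)
  have "((\<lambda>y. transpose (?G y)) has_derivative (\<lambda>h. transpose (dG h))) (at x)"
  proof -
    have "linear (transpose :: real^3^3 \<Rightarrow> real^3^3)"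
      by (rule linearI) (simp_all add: transpose_def vec_eq_iff)
    then have "bounded_linear (transpose :: real^3^3 \<Rightarrow> real^3^3)"
      by (simp add: linear_conv_bounded_linear)
    from bounded_linear.has_derivative[OF this dG] show ?thesis .
  qed
  then have "(?G has_derivative (\<lambda>h. transpose (dG h))) (at x)"
    using has_derivative_transform_within_open[OF _ S] sym by blast
  then have "dG = (\<lambda>h. transpose (dG h))" using dG has_derivative_unique by blast
  then have dsym: "dG h $ i $ j = dG h $ j $ i" for h i j
    by (metis (no_types, lifting) transpose_def vec_lambda_beta)
  have dsum: "dG u $ j $ l = (\<Sum>i\<in>UNIV. u $ i * dG (axis i 1) $ j $ l)" for j l
  proof -
    have "dG u = dG (\<Sum>i\<in>UNIV. u $ i *\<^sub>R axis i 1)"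
      using basis_expansion[of u] by (simp add: scalar_mult_eq_scaleR)
    also have "\<dots> = (\<Sum>i\<in>UNIV. u $ i *\<^sub>R dG (axis i 1))"
      by (simp add: linear_sum[OF lin] linear_scale[OF lin])
    finally show ?thesis by simp
  qed
  have lower: "w \<bullet> (?G x *v christoffel_map A g c x u v) =
     (\<Sum>i\<in>UNIV. \<Sum>j\<in>UNIV. \<Sum>l\<in>UNIV. u $ i * v $ j * w $ l / 2 *
        (dG (axis i 1) $ j $ l + dG (axis j 1) $ i $ l - dG (axis l 1) $ i $ j))" for v w
    by (subst matrix_mult_christoffel_map[OF inv])
       (simp add: inner_sum_right dG_def, simp add: inner_vec_def sum_distrib_left sum_divide_distrib mult_ac)
  have swap: "v \<bullet> (?G x *v christoffel_map A g c x u w) =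
     (\<Sum>i\<in>UNIV. \<Sum>j\<in>UNIV. \<Sum>l\<in>UNIV. u $ i * v $ j * w $ l / 2 *
        (dG (axis i 1) $ j $ l + dG (axis l 1) $ i $ j - dG (axis j 1) $ i $ l))"
    unfolding lower
    by (rule sum.cong[OF refl], subst sum.swap) (simp add: dsym[of "axis _ 1"] mult_ac)
  have "christoffel_map A g c x u v \<bullet> (?G x *v w) = w \<bullet> (?G x *v christoffel_map A g c x u v)"
    using sym[OF S(2)] by (rule inner_matrix_vector_symmetric)
  then have "christoffel_map A g c x u v \<bullet> (?G x *v w) + v \<bullet> (?G x *v christoffel_map A g c x u w)
    = (\<Sum>i\<in>UNIV. \<Sum>j\<in>UNIV. \<Sum>l\<in>UNIV. u $ i * v $ j * w $ l * dG (axis i 1) $ j $ l)"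
    by (simp only: lower[of w v] swap flip: sum.distrib) (simp add: algebra_simps)
  also have "\<dots> = (\<Sum>j\<in>UNIV. \<Sum>l\<in>UNIV. \<Sum>i\<in>UNIV. u $ i * v $ j * w $ l * dG (axis i 1) $ j $ l)"
    by (subst sum.swap) (rule sum.cong[OF refl], rule sum.swap)
  also have "\<dots> = v \<bullet> (dG u *v w)"
    by (simp add: inner_vec_def matrix_vector_mult_def dsum sum_distrib_left sum_distrib_right mult_ac)
  finally show ?thesis by (simp add: dG_def)
qed

section \<open>Tangent vectors in charts\<close>
lemma smooth_on_imp_differentiable: "smooth_on S f \<Longrightarrow> x \<in> S \<Longrightarrow> f differentiable (at x)"
  unfolding smooth_on_def by (metis Ck_on.simps(2))

locale smooth_manifold =
  fixes M :: "'m topology" and A :: "'m chart set"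
  assumes manifold: "smooth_3_manifold M A"
begin

lemma chart_homeomorphic:
  assumes "c \<in> A"
  shows "homeomorphic_map (subtopology M (fst c)) (top_of_set (snd c ` fst c)) (snd c)"
    and "openin M (fst c)" and "open (snd c ` fst c)"
  using assms manifold by (auto simp: smooth_3_manifold_def)

lemma chart_domain_subset: "c \<in> A \<Longrightarrow> fst c \<subseteq> topspace M"
  using chart_homeomorphic(2) openin_subset by blast

lemma inj_on_chart: "c \<in> A \<Longrightarrow> inj_on (snd c) (fst c)"
  using homeomorphic_imp_injective_map[OF chart_homeomorphic(1), of c] chart_domain_subset[of c]
  by (simp add: inf.absorb2)

lemma chart_inv_chart: "c \<in> A \<Longrightarrow> p \<in> fst c \<Longrightarrow> chart_inv c (snd c p) = p"
  by (simp add: chart_inv_def inv_into_f_f inj_on_chart)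

lemma chart_exists: "p \<in> topspace M \<Longrightarrow> \<exists>c\<in>A. p \<in> fst c"
  using manifold by (auto simp: smooth_3_manifold_def)

lemma open_chart_image:
  assumes "c \<in> A" "openin M U" "U \<subseteq> fst c"
  shows "open (snd c ` U)"
proof -
  have "openin (subtopology M (fst c)) U"
    using assms unfolding openin_subtopology by blast
  then have "openin (top_of_set (snd c ` fst c)) (snd c ` U)"
    using homeomorphic_map_openness_eq[OF chart_homeomorphic(1)[OF assms(1)]] by blast
  then show ?thesis using chart_homeomorphic(3)[OF assms(1)] openin_open_trans by blast
qed

lemma transition_chart: "c \<in> A \<Longrightarrow> p \<in> fst c \<Longrightarrow> transition c d (snd c p) = snd d p"
  by (simp add: transition_def chart_inv_chart)

lemma transition_has_derivative:
  assumes "c \<in> A" "d \<in> A" "p \<in> fst c" "p \<in> fst d"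
  shows "(transition c d has_derivative frechet_derivative (transition c d) (at (snd c p))) (at (snd c p))"
proof -
  have "smooth_on (snd c ` (fst c \<inter> fst d)) (transition c d)"
    using assms manifold by (auto simp: smooth_3_manifold_def)
  then have "transition c d differentiable (at (snd c p))"
    using assms by (auto intro: smooth_on_imp_differentiable)
  then show ?thesis by (simp flip: frechet_derivative_works)
qed

text \<open>The chain rule for \<open>transition c e = transition d e \<circ> transition c d\<close>, an identity that needs to hold only on the coordinates
  of the intersection of the three domains, a neighbourhood of \<open>snd c p\<close>.\<close>
lemma transition_derivative_cocycle:
  assumes "c \<in> A" "d \<in> A" "e \<in> A" "p \<in> fst c" "p \<in> fst d" "p \<in> fst e"
  shows "frechet_derivative (transition c e) (at (snd c p)) x =
    frechet_derivative (transition d e) (at (snd d p)) (frechet_derivative (transition c d) (at (snd c p)) x)"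
proof -
  let ?U = "fst c \<inter> fst d \<inter> fst e"
  have U: "open (snd c ` ?U)"
    using assms by (intro open_chart_image openin_Int chart_homeomorphic(2)) auto
  have 1: "((transition d e \<circ> transition c d) has_derivative
      (frechet_derivative (transition d e) (at (snd d p)) \<circ> frechet_derivative (transition c d) (at (snd c p))))
      (at (snd c p))"
    using assms by (intro diff_chain_at) (simp_all add: transition_chart transition_has_derivative)
  have "(transition c e has_derivative
      (frechet_derivative (transition d e) (at (snd d p)) \<circ> frechet_derivative (transition c d) (at (snd c p))))
      (at (snd c p))"
    by (rule has_derivative_transform_within_open[OF 1 U]) (use assms in \<open>auto simp: transition_chart\<close>)
  from has_derivative_unique[OF transition_has_derivative this] assms
  show ?thesis by simp
qed

text \<open>Together with the next three lemmas, this makes \<open>of_coords A c p\<close> a linear isomorphism from the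
  coordinate space onto the tangent space at \<open>p\<close>, with inverse \<open>\<lambda>u. u c\<close>.  Pointwise statements about
  tangent vectors can therefore be proved in the coordinates of a single chart.\<close>
lemma linear_of_coords:
  assumes "c \<in> A" "p \<in> fst c"
  shows "of_coords A c p (x + y) = of_coords A c p x + of_coords A c p y"
    and "of_coords A c p (r *\<^sub>R x) = r *\<^sub>R of_coords A c p x"
proof -
  have "linear (frechet_derivative (transition c d) (at (snd c p)))" if "d \<in> A" "p \<in> fst d" for d
    using transition_has_derivative[OF assms(1) that(1) assms(2) that(2)] has_derivative_linear by blast
  then show "of_coords A c p (x + y) = of_coords A c p x + of_coords A c p y"
    and "of_coords A c p (r *\<^sub>R x) = r *\<^sub>R of_coords A c p x"
    by (auto simp: of_coords_def at_charts_def fun_eq_iff linear_add linear_scale)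
qed

lemma of_coords_in_tangent_space:
  assumes "c \<in> A" "p \<in> fst c"
  shows "of_coords A c p x \<in> tangent_space A p"
  unfolding tangent_space_def
proof (intro CollectI conjI ballI impI)
  show "at_charts A p (of_coords A c p x) = of_coords A c p x"
    by (simp add: of_coords_def at_charts_def fun_eq_iff)
  fix d e assume "d \<in> A" "e \<in> A" "p \<in> fst d" "p \<in> fst e"
  then show "of_coords A c p x e =
      frechet_derivative (transition d e) (at (snd d p)) (of_coords A c p x d)"
    using transition_derivative_cocycle[of c d e p x] assms by (simp add: of_coords_def at_charts_def)
qed

lemma of_coords_same_chart:
  assumes "c \<in> A" "p \<in> fst c"
  shows "of_coords A c p x c = x"
proof -
  have "(transition c c has_derivative (\<lambda>x. x)) (at (snd c p))"
    by (rule has_derivative_transform_within_open[OF has_derivative_ident chart_homeomorphic(3)[OF assms(1)]])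
       (use assms in \<open>auto simp: transition_chart\<close>)
  from has_derivative_unique[OF transition_has_derivative this] assms
  show ?thesis by (simp add: of_coords_def at_charts_def)
qed

lemma of_coords_component:
  assumes "c \<in> A" "p \<in> fst c" "u \<in> tangent_space A p"
  shows "of_coords A c p (u c) = u"
proof
  fix d
  have u: "at_charts A p u = u" using assms(3) unfolding tangent_space_def by blast
  show "of_coords A c p (u c) d = u d"
  proof (cases "d \<in> A \<and> p \<in> fst d")
    case True
    then have "u d = frechet_derivative (transition c d) (at (snd c p)) (u c)"
      using assms unfolding tangent_space_def by blast
    with True show ?thesis by (simp add: of_coords_def at_charts_def)
  next
    case False
    then show ?thesis using fun_cong[OF u, of d] by (auto simp: of_coords_def at_charts_def)
  qed
qed

lemma tangent_vector_eqI:
  assumes "c \<in> A" "p \<in> fst c" "u \<in> tangent_space A p" "v \<in> tangent_space A p" "u c = v c"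
  shows "u = v"
proof -
  have "u = of_coords A c p (u c)" using assms(1-3) by (rule of_coords_component[symmetric])
  also have "\<dots> = of_coords A c p (v c)" by (simp only: assms(5))
  also have "\<dots> = v" using assms(1,2,4) by (rule of_coords_component)
  finally show ?thesis .
qed

lemma
  assumes "p \<in> topspace M"
  shows tangent_space_add: "u \<in> tangent_space A p \<Longrightarrow> v \<in> tangent_space A p \<Longrightarrow> u + v \<in> tangent_space A p"
    and tangent_space_scaleR: "u \<in> tangent_space A p \<Longrightarrow> r *\<^sub>R u \<in> tangent_space A p"
proof -
  obtain c where c: "c \<in> A" "p \<in> fst c" using chart_exists assms by blast
  show "u + v \<in> tangent_space A p" if "u \<in> tangent_space A p" "v \<in> tangent_space A p"
    using of_coords_in_tangent_space[OF c, of "u c + v c"]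
    by (simp only: linear_of_coords[OF c] of_coords_component[OF c that(1)] of_coords_component[OF c that(2)])
  show "r *\<^sub>R u \<in> tangent_space A p" if "u \<in> tangent_space A p"
    using of_coords_in_tangent_space[OF c, of "r *\<^sub>R u c"]
    by (simp only: linear_of_coords[OF c] of_coords_component[OF c that])
qed

end

locale metric_manifold = smooth_manifold M A
  for M :: "'m topology" and A :: "'m chart set" +
  fixes g :: "'m \<Rightarrow> 'm tvec \<Rightarrow> 'm tvec \<Rightarrow> real"
  assumes metric: "pseudo_riemannian_metric M A g"
begin

lemma metric_symmetric:
  "p \<in> topspace M \<Longrightarrow> u \<in> tangent_space A p \<Longrightarrow> v \<in> tangent_space A p \<Longrightarrow> g p u v = g p v u"
  using metric by (simp add: pseudo_riemannian_metric_def)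

lemma metric_add:
  "p \<in> topspace M \<Longrightarrow> u \<in> tangent_space A p \<Longrightarrow> v \<in> tangent_space A p \<Longrightarrow> w \<in> tangent_space A p
    \<Longrightarrow> g p u (v + w) = g p u v + g p u w"
  using metric by (auto simp: pseudo_riemannian_metric_def linear_map_on_def)

lemma metric_scaleR:
  "p \<in> topspace M \<Longrightarrow> u \<in> tangent_space A p \<Longrightarrow> v \<in> tangent_space A p
    \<Longrightarrow> g p u (r *\<^sub>R v) = r * g p u v"
  using metric by (auto simp: pseudo_riemannian_metric_def linear_map_on_def)

lemma bilinear_metric_of_coords:
  assumes c: "c \<in> A" "p \<in> fst c"
  shows "bilinear (\<lambda>u v. g p (of_coords A c p u) (of_coords A c p v))" (is "bilinear ?B")
proof -
  have p: "p \<in> topspace M" using chart_domain_subset c by blast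
  have right: "?B u (v + w) = ?B u v + ?B u w" "?B u (r *\<^sub>R v) = r *\<^sub>R ?B u v" for u v w r
    using of_coords_in_tangent_space[OF c] metric_add[OF p] metric_scaleR[OF p]
    by (simp_all add: linear_of_coords[OF c])
  have sym: "?B u v = ?B v u" for u v
    by (intro metric_symmetric[OF p] of_coords_in_tangent_space[OF c])
  have "linear (?B u)" for u
    by (rule linearI) (simp_all only: right)
  moreover have "linear (\<lambda>v. ?B v u)" for u
    by (rule linearI) (simp_all only: sym[of _ u] right)
  ultimately show ?thesis by (simp add: bilinear_def)
qed

lemma inner_metric_comps:
  assumes c: "c \<in> A" "p \<in> fst c"
  shows "u \<bullet> (metric_comps A g c (snd c p) *v w) = g p (of_coords A c p u) (of_coords A c p w)"
proof -
  let ?B = "\<lambda>u v. g p (of_coords A c p u) (of_coords A c p v)"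
  note bil = bilinear_metric_of_coords[OF c]
  have e: "(\<Sum>i\<in>UNIV. x $ i *\<^sub>R axis i 1) = x" for x :: "real^3"
    using basis_expansion[of x] by (simp add: scalar_mult_eq_scaleR)
  have l: "linear (?B x)" "linear (\<lambda>y. ?B y x)" for x
    using bil by (auto simp: bilinear_def)
  have "?B u w = (\<Sum>i\<in>UNIV. u $ i * ?B (axis i 1) w)"
    by (subst (1) e[of u, symmetric]) (simp only: linear_sum[OF l(2)] linear_scale[OF l(2)] real_scaleR_def)
  also have "\<dots> = (\<Sum>i\<in>UNIV. u $ i * (\<Sum>j\<in>UNIV. w $ j * ?B (axis i 1) (axis j 1)))"
    by (subst (1) e[of w, symmetric]) (simp only: linear_sum[OF l(1)] linear_scale[OF l(1)] real_scaleR_def)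
  finally show ?thesis
    by (simp add: inner_vec_def matrix_vector_mult_def metric_comps_def chart_inv_chart[OF c] mult.commute)
qed

lemma metric_eq_inner:
  assumes "c \<in> A" "p \<in> fst c" "u \<in> tangent_space A p" "v \<in> tangent_space A p"
  shows "g p u v = u c \<bullet> (metric_comps A g c (snd c p) *v v c)"
  using assms by (simp add: inner_metric_comps of_coords_component)

lemma metric_of_coords_nondegenerate:
  assumes c: "c \<in> A" "p \<in> fst c"
    and "\<And>v. g p (of_coords A c p u) (of_coords A c p v) = 0"
  shows "u = 0"
proof -
  have p: "p \<in> topspace M" using chart_domain_subset c by blast
  have "g p (of_coords A c p u) v = 0" if "v \<in> tangent_space A p" for v
    using assms(3)[of "v c"] of_coords_component[OF c that] by simp
  then have "of_coords A c p u = 0"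
    using metric p of_coords_in_tangent_space[OF c] by (auto simp: pseudo_riemannian_metric_def)
  then show ?thesis using of_coords_same_chart[OF c, of u] by simp
qed

lemma transpose_metric_comps:
  assumes c: "c \<in> A" "p \<in> fst c"
  shows "transpose (metric_comps A g c (snd c p)) = metric_comps A g c (snd c p)"
proof -
  have p: "p \<in> topspace M" using chart_domain_subset c by blast
  show ?thesis
    using metric_symmetric[OF p] of_coords_in_tangent_space[OF c]
    by (simp add: transpose_def metric_comps_def chart_inv_chart[OF c] vec_eq_iff)
qed

lemma invertible_metric_comps:
  assumes c: "c \<in> A" "p \<in> fst c"
  shows "invertible (metric_comps A g c (snd c p))" (is "invertible ?G")
proof -
  have "x = 0" if "?G *v x = 0" for x
  proof (rule metric_of_coords_nondegenerate[OF c])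
    fix v
    have "g p (of_coords A c p x) (of_coords A c p v) = v \<bullet> (?G *v x)"
      by (metis inner_metric_comps[OF c] inner_matrix_vector_symmetric[OF transpose_metric_comps[OF c]])
    then show "g p (of_coords A c p x) (of_coords A c p v) = 0" using that by simp
  qed
  then have "inj ((*v) ?G)" by (simp add: linear_injective_0[OF matrix_vector_mul_linear])
  then show ?thesis by (simp add: invertible_left_inverse matrix_left_invertible_injective)
qed

lemma christoffel_map_compatible:
  assumes c: "c \<in> A" "p \<in> fst c"
  shows "christoffel_map A g c (snd c p) u v \<bullet> (metric_comps A g c (snd c p) *v w)
       + v \<bullet> (metric_comps A g c (snd c p) *v christoffel_map A g c (snd c p) u w)
       = v \<bullet> (frechet_derivative (metric_comps A g c) (at (snd c p)) u *v w)"
proof (rule christoffel_map_metric)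
  show "metric_comps A g c differentiable (at (snd c p))"
    using metric c by (auto simp: pseudo_riemannian_metric_def intro!: smooth_on_imp_differentiable)
  show "open (snd c ` fst c)" using c chart_homeomorphic(3) by blast
  show "transpose (metric_comps A g c y) = metric_comps A g c y" if "y \<in> snd c ` fst c" for y
    using that transpose_metric_comps[OF c(1)] by blast
qed (use c invertible_metric_comps in auto)

end

section \<open>Covariant derivatives along a curve\<close>

text \<open>Two derivatives of the coordinates suffice for the acceleration of a curve.\<close>
lemma smooth_param_imp_differentiable:
  assumes "smooth_param J f" "t \<in> J"
  shows "f differentiable (at t within J)"
    and "(\<lambda>s. vector_derivative f (at s within J)) differentiable (at t within J)"
proof -
  have "Ck_param (Suc (Suc 0)) J f" using assms(1) unfolding smooth_param_def by blast
  then show "f differentiable (at t within J)"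
    and "(\<lambda>s. vector_derivative f (at s within J)) differentiable (at t within J)"
    using assms(2) by auto
qed

lemma bounded_bilinear_matrix_vector_mult:
  "bounded_bilinear ((*v) :: real ^ 'n ^ 'm \<Rightarrow> real ^ 'n \<Rightarrow> real ^ 'm)"
proof -
  have "bilinear ((*v) :: real ^ 'n ^ 'm \<Rightarrow> real ^ 'n \<Rightarrow> real ^ 'm)"
    unfolding bilinear_def
    by (auto intro!: linearI simp: matrix_vector_right_distrib matrix_vector_mult_add_rdistrib
      matrix_vector_mult_scaleR scaleR_matrix_vector_assoc)
  then show ?thesis by (simp add: bilinear_conv_bounded_bilinear)
qed

lemma has_vector_derivative_chain:
  assumes "(x has_vector_derivative v) (at t within I)" and "f differentiable (at (x t))"
  shows "((\<lambda>s. f (x s)) has_vector_derivative frechet_derivative f (at (x t)) v) (at t within I)"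
proof -
  have f: "(f has_derivative frechet_derivative f (at (x t))) (at (x t))"
    using assms(2) by (simp flip: frechet_derivative_works)
  then have "linear (frechet_derivative f (at (x t)))" by (rule has_derivative_linear)
  then show ?thesis
    using has_derivative_compose[OF assms(1)[unfolded has_vector_derivative_def] f]
    by (simp add: has_vector_derivative_def linear_scale)
qed

locale curve_in_metric_manifold = metric_manifold M A g
  for M :: "'m topology" and A :: "'m chart set" and g +
  fixes I :: "real set" and C :: "real \<Rightarrow> 'm"
  assumes curve: "smooth_curve M A I C"
begin

lemma at_within_param_nontrivial: "t \<in> I \<Longrightarrow> at t within I \<noteq> bot"
proof -
  assume t: "t \<in> I"
  have "connected I" "interior I \<noteq> {}"
    using curve by (auto simp: smooth_curve_def is_interval_connected)
  moreover from this have "\<nexists>a. I = {a}" by auto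
  ultimately have "t islimpt I" using t connected_imp_perfect by blast
  then show ?thesis by (simp add: trivial_limit_within)
qed

lemma curve_in_topspace: "t \<in> I \<Longrightarrow> C t \<in> topspace M"
  using curve continuous_map_image_subset_topspace[of "top_of_set I" M C] by (auto simp: smooth_curve_def)

lemma chart_domain_preimage:
  assumes "t \<in> I" "c \<in> A" "C t \<in> fst c"
  obtains T where "open T" "t \<in> T" "\<And>s. s \<in> I \<Longrightarrow> s \<in> T \<longleftrightarrow> C s \<in> fst c"
proof -
  have "openin (top_of_set I) {s \<in> I. C s \<in> fst c}"
    using openin_continuous_map_preimage[of "top_of_set I" M C "fst c"] curve chart_homeomorphic(2)[OF assms(2)]
    by (simp add: smooth_curve_def)
  then obtain T where T: "open T" "{s \<in> I. C s \<in> fst c} = I \<inter> T"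
    unfolding openin_open by blast
  then show ?thesis using that[of T] assms by blast
qed

lemma eventually_in_chart:
  assumes "t \<in> I" "c \<in> A" "C t \<in> fst c"
  shows "\<forall>\<^sub>F s in at t within I. s \<in> I \<and> C s \<in> fst c"
proof -
  obtain T where T: "open T" "t \<in> T" "\<And>s. s \<in> I \<Longrightarrow> s \<in> T \<longleftrightarrow> C s \<in> fst c"
    using chart_domain_preimage[OF assms] by blast
  then show ?thesis unfolding eventually_at_topological by blast
qed

text \<open>Smoothness of a curve is expressed on the parameters that it maps into a chart, velocity and covariant
  derivative on the whole interval.  The former set is relatively open in the latter, so both have the same
  derivatives.\<close>
lemma at_within_chart_domain:
  assumes "t \<in> I" "c \<in> A" "C t \<in> fst c"
  shows "at t within {s \<in> I. C s \<in> fst c} = at t within I"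
proof -
  obtain T where T: "open T" "t \<in> T" "\<And>s. s \<in> I \<Longrightarrow> s \<in> T \<longleftrightarrow> C s \<in> fst c"
    using chart_domain_preimage[OF assms] by blast
  show ?thesis by (rule at_within_nhd[OF T(2,1)]) (use T(3) in auto)
qed

text \<open>The regularity on which the product rules rest.  The velocity, the restrictions of ambient fields and the
  vectors of a Frenet frame have it.\<close>
definition differentiable_field :: "'m chart \<Rightarrow> real \<Rightarrow> (real \<Rightarrow> 'm tvec) \<Rightarrow> bool"
  where "differentiable_field c t V \<longleftrightarrow>
    (\<forall>s\<in>I. V s \<in> tangent_space A (C s)) \<and> (\<lambda>s. V s c) differentiable (at t within I)"

lemma differentiable_fieldD:
  assumes "differentiable_field c t V"
  shows "s \<in> I \<Longrightarrow> V s \<in> tangent_space A (C s)"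
    and "((\<lambda>s. V s c) has_vector_derivative vector_derivative (\<lambda>s. V s c) (at t within I)) (at t within I)"
  using assms by (auto simp: differentiable_field_def simp flip: vector_derivative_works)

lemma coordinates_has_velocity:
  assumes "t \<in> I" "c \<in> A" "C t \<in> fst c"
  shows "((\<lambda>s. snd c (C s)) has_vector_derivative velocity A I C t c) (at t within I)"
proof -
  have "smooth_param {s \<in> I. C s \<in> fst c} (\<lambda>s. snd c (C s))"
    using curve assms by (simp add: smooth_curve_def)
  then have "(\<lambda>s. snd c (C s)) differentiable (at t within I)"
    using smooth_param_imp_differentiable(1)[of _ _ t] at_within_chart_domain[OF assms] assms by fastforce
  then show ?thesis using assms by (simp add: velocity_def at_charts_def flip: vector_derivative_works)
qed

text \<open>The coordinates of the velocity transform by the chain rule; uniqueness of the one-sided derivatives at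
  end points of \<open>I\<close> holds because \<open>I\<close> has no isolated points.\<close>
lemma velocity_in_tangent_space:
  assumes "t \<in> I"
  shows "velocity A I C t \<in> tangent_space A (C t)"
  unfolding tangent_space_def
proof (intro CollectI conjI ballI impI)
  show "at_charts A (C t) (velocity A I C t) = velocity A I C t"
    by (simp add: velocity_def at_charts_def fun_eq_iff)
  fix c d assume c: "c \<in> A" "C t \<in> fst c" and d: "d \<in> A" "C t \<in> fst d"
  let ?T = "frechet_derivative (transition c d) (at (snd c (C t)))"
  have "transition c d differentiable (at (snd c (C t)))"
    using transition_has_derivative c d unfolding differentiable_def by blast
  from has_vector_derivative_chain[OF coordinates_has_velocity[OF assms c] this]
  have 1: "((\<lambda>s. transition c d (snd c (C s))) has_derivative (\<lambda>h. h *\<^sub>R ?T (velocity A I C t c))) (at t within I)"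
    by (simp add: has_vector_derivative_def)
  have "((\<lambda>s. snd d (C s)) has_derivative (\<lambda>h. h *\<^sub>R ?T (velocity A I C t c))) (at t within I)"
    by (rule has_derivative_transform_eventually[OF 1 eventually_mono[OF eventually_in_chart[OF assms c]]])
       (use assms c in \<open>auto simp: transition_chart\<close>)
  from vector_derivative_unique_within[OF at_within_param_nontrivial[OF assms]
      coordinates_has_velocity[OF assms d] this[folded has_vector_derivative_def]]
  show "velocity A I C t d = ?T (velocity A I C t c)" .
qed

lemma has_vector_derivative_transform_in_chart:
  assumes t: "t \<in> I" "c \<in> A" "C t \<in> fst c"
    and f: "(f has_vector_derivative d) (at t within I)"
    and eq: "\<And>s. s \<in> I \<Longrightarrow> C s \<in> fst c \<Longrightarrow> f s = h s"
  shows "(h has_vector_derivative d) (at t within I)"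
  unfolding has_vector_derivative_def
  by (rule has_derivative_transform_eventually[OF f[unfolded has_vector_derivative_def]
        eventually_mono[OF eventually_in_chart[OF t]]]) (use t eq in auto)

lemma smooth_param_in_chart_imp_differentiable:
  assumes t: "t \<in> I" "c \<in> A" "C t \<in> fst c" and "smooth_param {s \<in> I. C s \<in> fst c} f"
  shows "f differentiable (at t within I)"
  using smooth_param_imp_differentiable(1)[OF assms(4), of t] at_within_chart_domain[OF t] t by simp

lemma differentiable_field_velocity:
  assumes t: "t \<in> I" "c \<in> A" "C t \<in> fst c"
  shows "differentiable_field c t (velocity A I C)"
proof -
  let ?J = "{s \<in> I. C s \<in> fst c}"
  have "(\<lambda>s. vector_derivative (\<lambda>r. snd c (C r)) (at s within ?J)) differentiable (at t within I)"
    using smooth_param_imp_differentiable(2)[of ?J "\<lambda>s. snd c (C s)" t] at_within_chart_domain[OF t] t curve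
    by (simp add: smooth_curve_def)
  then obtain d where d: "((\<lambda>s. vector_derivative (\<lambda>r. snd c (C r)) (at s within ?J)) has_vector_derivative d) (at t within I)"
    using vector_derivative_works by blast
  have "((\<lambda>s. velocity A I C s c) has_vector_derivative d) (at t within I)"
    by (rule has_vector_derivative_transform_in_chart[OF t d])
       (use t at_within_chart_domain in \<open>simp add: velocity_def at_charts_def\<close>)
  then show ?thesis
    using velocity_in_tangent_space by (auto simp: differentiable_field_def intro: differentiableI_vector)
qed

lemma differentiable_field_smooth:
  assumes t: "t \<in> I" "c \<in> A" "C t \<in> fst c" and "smooth_field_along A I C V"
  shows "differentiable_field c t V"
  using assms smooth_param_in_chart_imp_differentiable[OF t]
  by (auto simp: smooth_field_along_def differentiable_field_def)

lemma differentiable_field_restriction: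
  assumes t: "t \<in> I" "c \<in> A" "C t \<in> fst c" and X: "smooth_vector_field M A X"
  shows "differentiable_field c t (\<lambda>s. X (C s))"
proof -
  have "(\<lambda>x. X (chart_inv c x) c) differentiable (at (snd c (C t)))"
    using X t by (auto simp: smooth_vector_field_def intro!: smooth_on_imp_differentiable)
  from has_vector_derivative_transform_in_chart[OF t has_vector_derivative_chain[OF coordinates_has_velocity[OF t] this]]
  have "((\<lambda>s. X (C s) c) has_vector_derivative
      frechet_derivative (\<lambda>x. X (chart_inv c x) c) (at (snd c (C t))) (velocity A I C t c)) (at t within I)"
    using t by (simp add: chart_inv_chart)
  then show ?thesis
    using X curve_in_topspace
    by (auto simp: smooth_vector_field_def differentiable_field_def intro: differentiableI_vector)
qed

text \<open>Differentiating the coordinate expression of \<open>g(U, V)\<close> also differentiates the metric components along the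
  curve; metric compatibility turns this term into the Christoffel parts of \<open>\<nabla>U\<close> and \<open>\<nabla>V\<close>.\<close>
lemma metric_derivative_along:
  assumes t: "t \<in> I" "c \<in> A" "C t \<in> fst c" and U: "differentiable_field c t U" and V: "differentiable_field c t V"
  shows "((\<lambda>s. g (C s) (U s) (V s)) has_vector_derivative
    nabla_along A g I C U t c \<bullet> (metric_comps A g c (snd c (C t)) *v V t c)
    + U t c \<bullet> (metric_comps A g c (snd c (C t)) *v nabla_along A g I C V t c)) (at t within I)"
proof -
  let ?x = "snd c (C t)" let ?G = "metric_comps A g c"
  let ?v = "velocity A I C t c" let ?\<Gamma> = "christoffel_map A g c ?x ?v"
  let ?dU = "vector_derivative (\<lambda>s. U s c) (at t within I)"
  let ?dV = "vector_derivative (\<lambda>s. V s c) (at t within I)"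
  have "?G differentiable (at ?x)"
    using metric t by (auto simp: pseudo_riemannian_metric_def intro!: smooth_on_imp_differentiable)
  note dG = has_vector_derivative_chain[OF coordinates_has_velocity[OF t] this]
  note d = bounded_bilinear.has_vector_derivative[OF bounded_bilinear_inner differentiable_fieldD(2)[OF U]
      bounded_bilinear.has_vector_derivative[OF bounded_bilinear_matrix_vector_mult dG differentiable_fieldD(2)[OF V]]]
  have "((\<lambda>s. g (C s) (U s) (V s)) has_vector_derivative
     U t c \<bullet> (?G ?x *v ?dV + frechet_derivative ?G (at ?x) ?v *v V t c) + ?dU \<bullet> (?G ?x *v V t c)) (at t within I)"
    by (rule has_vector_derivative_transform_in_chart[OF t d])
       (use t differentiable_fieldD(1)[OF U] differentiable_fieldD(1)[OF V] in \<open>simp add: metric_eq_inner\<close>)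
  moreover have "nabla_along A g I C U t c = ?dU + ?\<Gamma> (U t c)" "nabla_along A g I C V t c = ?dV + ?\<Gamma> (V t c)"
    using t by (simp_all add: nabla_along_def at_charts_def)
  ultimately show ?thesis
    using christoffel_map_compatible[OF t(2,3), of ?v "U t c" "V t c"]
    by (simp add: inner_add_left inner_add_right matrix_vector_right_distrib algebra_simps)
qed

end

context smooth_manifold
begin

lemma endo_comps_mult:
  assumes \<phi>: "smooth_endomorphism M A \<phi>" and c: "c \<in> A" "p \<in> fst c"
  shows "endo_comps A \<phi> c (snd c p) *v x = \<phi> p (of_coords A c p x) c"
proof -
  have p: "p \<in> topspace M" using chart_domain_subset c by blast
  have lin: "linear_map_on (tangent_space A p) (\<phi> p)" using \<phi> p by (simp add: smooth_endomorphism_def)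
  have "linear (\<lambda>x. \<phi> p (of_coords A c p x) c)"
    using lin of_coords_in_tangent_space[OF c]
    by (intro linearI) (simp_all add: linear_of_coords[OF c] linear_map_on_def)
  moreover have "endo_comps A \<phi> c (snd c p) = matrix (\<lambda>x. \<phi> p (of_coords A c p x) c)"
    by (simp add: endo_comps_def matrix_def chart_inv_chart[OF c])
  ultimately show ?thesis by (simp add: matrix_works)
qed

end

context curve_in_metric_manifold
begin

text \<open>The product rule for a matrix acting on a vector; the Christoffel term of \<open>\<phi> (\<nabla>V)\<close> cancels the negative one
  in \<open>\<nabla>\<phi>\<close>.\<close>
lemma endomorphism_derivative_along:
  assumes t: "t \<in> I" "c \<in> A" "C t \<in> fst c" and V: "differentiable_field c t V"
    and \<phi>: "smooth_endomorphism M A \<phi>"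
  shows "differentiable_field c t (\<lambda>s. \<phi> (C s) (V s))"
    and "nabla_along A g I C (\<lambda>s. \<phi> (C s) (V s)) t c =
      nabla_endo A g \<phi> (C t) (velocity A I C t) (V t) c
      + endo_comps A \<phi> c (snd c (C t)) *v nabla_along A g I C V t c"
proof -
  let ?x = "snd c (C t)" let ?F = "endo_comps A \<phi> c"
  let ?v = "velocity A I C t c" let ?dV = "vector_derivative (\<lambda>s. V s c) (at t within I)"
  have F: "?F (snd c (C s)) *v V s c = \<phi> (C s) (V s) c" if "s \<in> I" "C s \<in> fst c" for s
    using endo_comps_mult[OF \<phi> t(2) that(2)] of_coords_component[OF t(2) that(2)] differentiable_fieldD(1)[OF V that(1)]
    by simp
  have "?F differentiable (at ?x)"
    using \<phi> t by (auto simp: smooth_endomorphism_def intro!: smooth_on_imp_differentiable)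
  note d = bounded_bilinear.has_vector_derivative[OF bounded_bilinear_matrix_vector_mult
      has_vector_derivative_chain[OF coordinates_has_velocity[OF t] this] differentiable_fieldD(2)[OF V]]
  have D: "((\<lambda>s. \<phi> (C s) (V s) c) has_vector_derivative
      ?F ?x *v ?dV + frechet_derivative ?F (at ?x) ?v *v V t c) (at t within I)"
    by (rule has_vector_derivative_transform_in_chart[OF t d]) (rule F)
  have "\<phi> (C s) (V s) \<in> tangent_space A (C s)" if "s \<in> I" for s
    using \<phi> curve_in_topspace[OF that] differentiable_fieldD(1)[OF V that] by (auto simp: smooth_endomorphism_def)
  then show "differentiable_field c t (\<lambda>s. \<phi> (C s) (V s))"
    using D by (auto simp: differentiable_field_def intro: differentiableI_vector)
  show "nabla_along A g I C (\<lambda>s. \<phi> (C s) (V s)) t c =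
      nabla_endo A g \<phi> (C t) (velocity A I C t) (V t) c
      + endo_comps A \<phi> c (snd c (C t)) *v nabla_along A g I C V t c"
    using t vector_derivative_within[OF at_within_param_nontrivial[OF t(1)] D] F[OF t(1,3)]
    by (simp add: nabla_along_def nabla_endo_def at_charts_def Let_def matrix_vector_right_distrib)
qed

end

section \<open>Slant null curves in Sasaki-like manifolds\<close>
locale sasaki_like_manifold =
  fixes M :: "'m topology" and A :: "'m chart set" and \<phi> \<xi> \<eta> g
  assumes almost_contact: "almost_contact_B_metric_3_manifold M A \<phi> \<xi> \<eta> g"
    and sasaki: "sasaki_like M A \<phi> \<xi> \<eta> g"

sublocale sasaki_like_manifold \<subseteq> metric_manifold M A g
  using almost_contact by unfold_locales (auto simp: almost_contact_B_metric_3_manifold_def)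

context sasaki_like_manifold
begin

lemma
  shows smooth_\<phi>: "smooth_endomorphism M A \<phi>" and smooth_\<xi>: "smooth_vector_field M A \<xi>"
    and smooth_\<eta>: "smooth_1_form M A \<eta>"
  using almost_contact by (auto simp: almost_contact_B_metric_3_manifold_def)

lemma \<xi>_in_tangent_space: "p \<in> topspace M \<Longrightarrow> \<xi> p \<in> tangent_space A p"
  using smooth_\<xi> by (simp add: smooth_vector_field_def)

lemma \<phi>_in_tangent_space: "p \<in> topspace M \<Longrightarrow> u \<in> tangent_space A p \<Longrightarrow> \<phi> p u \<in> tangent_space A p"
  using smooth_\<phi> by (auto simp: smooth_endomorphism_def)

lemma almost_contact_B_space_in_chart:
  assumes c: "c \<in> A" "p \<in> fst c"
  shows "almost_contact_B_space (\<lambda>x. \<phi> p (of_coords A c p x) c) (\<xi> p c)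
    (\<lambda>x. \<eta> p (of_coords A c p x)) (\<lambda>x y. g p (of_coords A c p x) (of_coords A c p y))"
proof -
  have p: "p \<in> topspace M" using chart_domain_subset c by blast
  note T = of_coords_in_tangent_space[OF c]
  have \<phi>_lin: "linear_map_on (tangent_space A p) (\<phi> p)"
    using smooth_\<phi> p by (simp add: smooth_endomorphism_def)
  have \<eta>_lin: "linear_map_on (tangent_space A p) (\<eta> p)"
    using smooth_\<eta> p by (simp add: smooth_1_form_def)
  have \<phi>_coords: "of_coords A c p (\<phi> p (of_coords A c p x) c) = \<phi> p (of_coords A c p x)" for x
    by (rule of_coords_component[OF c \<phi>_in_tangent_space[OF p T]])
  have \<xi>_coords: "of_coords A c p (\<xi> p c) = \<xi> p"
    by (rule of_coords_component[OF c \<xi>_in_tangent_space[OF p]])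
  show ?thesis
  proof (rule almost_contact_B_space.intro)
    show "linear (\<lambda>x. \<phi> p (of_coords A c p x) c)"
      using \<phi>_lin T by (intro linearI) (simp_all add: linear_of_coords[OF c] linear_map_on_def)
    show "linear (\<lambda>x. \<eta> p (of_coords A c p x))"
      using \<eta>_lin T by (intro linearI) (simp_all add: linear_of_coords[OF c] linear_map_on_def)
    show "bilinear (\<lambda>x y. g p (of_coords A c p x) (of_coords A c p y))"
      by (rule bilinear_metric_of_coords[OF c])
    show "g p (of_coords A c p x) (of_coords A c p y) = g p (of_coords A c p y) (of_coords A c p x)" for x y
      by (rule metric_symmetric[OF p T T])
    show "x = 0" if "\<And>y. g p (of_coords A c p x) (of_coords A c p y) = 0" for x
      by (rule metric_of_coords_nondegenerate[OF c that])
    show "\<eta> p (of_coords A c p (\<xi> p c)) = 1"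
      using almost_contact p by (simp add: \<xi>_coords almost_contact_B_metric_3_manifold_def)
    show "\<phi> p (of_coords A c p (\<phi> p (of_coords A c p x) c)) c = - x + \<eta> p (of_coords A c p x) *\<^sub>R \<xi> p c" for x
      using almost_contact p T[of x]
      by (simp add: \<phi>_coords almost_contact_B_metric_3_manifold_def of_coords_same_chart[OF c])
    show "g p (of_coords A c p (\<phi> p (of_coords A c p x) c)) (of_coords A c p (\<phi> p (of_coords A c p y) c))
        = - g p (of_coords A c p x) (of_coords A c p y) + \<eta> p (of_coords A c p x) * \<eta> p (of_coords A c p y)" for x y
      using almost_contact p T[of x] T[of y]
      by (simp add: \<phi>_coords almost_contact_B_metric_3_manifold_def)
  qed
qed

lemma \<phi>_\<xi>:
  assumes p: "p \<in> topspace M"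
  shows "\<phi> p (\<xi> p) = 0"
proof -
  obtain c where c: "c \<in> A" "p \<in> fst c" using chart_exists p by blast
  interpret almost_contact_B_space "\<lambda>x. \<phi> p (of_coords A c p x) c" "\<xi> p c"
    "\<lambda>x. \<eta> p (of_coords A c p x)" "\<lambda>x y. g p (of_coords A c p x) (of_coords A c p y)"
    by (rule almost_contact_B_space_in_chart[OF c])
  show ?thesis
  proof (rule tangent_vector_eqI[OF c \<phi>_in_tangent_space[OF p \<xi>_in_tangent_space[OF p]]])
    show "0 \<in> tangent_space A p" using tangent_space_scaleR[OF p \<xi>_in_tangent_space[OF p], of 0] by simp
    show "\<phi> p (\<xi> p) c = 0 c" using f_\<xi> by (simp add: of_coords_component[OF c \<xi>_in_tangent_space[OF p]])
  qed
qed

lemma metric_\<xi>: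
  assumes p: "p \<in> topspace M" and u: "u \<in> tangent_space A p"
  shows "g p (\<xi> p) u = \<eta> p u"
proof -
  obtain c where c: "c \<in> A" "p \<in> fst c" using chart_exists p by blast
  interpret almost_contact_B_space "\<lambda>x. \<phi> p (of_coords A c p x) c" "\<xi> p c"
    "\<lambda>x. \<eta> p (of_coords A c p x)" "\<lambda>x y. g p (of_coords A c p x) (of_coords A c p y)"
    by (rule almost_contact_B_space_in_chart[OF c])
  show ?thesis
    using g_\<xi>[of "u c"] by (simp add: of_coords_component[OF c] u \<xi>_in_tangent_space[OF p])
qed

end

locale slant_null_curve = sasaki_like_manifold M A \<phi> \<xi> \<eta> g
  for M :: "'m topology" and A :: "'m chart set" and \<phi> \<xi> \<eta> g +
  fixes I :: "real set" and C :: "real \<Rightarrow> 'm" and a :: real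
  assumes null: "null_curve M A g I C" and slant: "slant A \<eta> I C a"

sublocale slant_null_curve \<subseteq> curve_in_metric_manifold M A g I C
  using null by unfold_locales (simp add: null_curve_def)

context slant_null_curve
begin

abbreviation V :: "real \<Rightarrow> 'm tvec" where "V \<equiv> velocity A I C"

definition b :: "real \<Rightarrow> real" where "b t = g (C t) (V t) (\<phi> (C t) (V t))"

definition D :: "real \<Rightarrow> real" where "D t = a ^ 4 + (b t)\<^sup>2"

lemma velocity_null:
  assumes "t \<in> I"
  shows "g (C t) (V t) (V t) = 0" "V t \<noteq> 0" "\<eta> (C t) (V t) = a"
  using null slant assms by (auto simp: null_curve_def slant_def)

text \<open>The constancy of \<open>g(V, V)\<close>, \<open>g(\<xi>, V)\<close>, \<open>g(\<xi>, \<xi>)\<close> and \<open>\<phi> \<xi>\<close> along the curve enters through this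
  lemma.\<close>
lemma constant_has_zero_derivative:
  assumes t: "t \<in> I" and "(f has_vector_derivative d) (at t within I)" and "\<And>s. s \<in> I \<Longrightarrow> f s = k"
  shows "d = 0"
proof -
  have "(f has_vector_derivative 0) (at t within I)"
    by (rule has_vector_derivative_transform[OF t _ has_vector_derivative_const[of k]]) (simp add: assms(3))
  then show ?thesis
    using vector_derivative_unique_within[OF at_within_param_nontrivial[OF t]] assms(2) by blast
qed

context
  fixes t c assumes t: "t \<in> I" and c: "c \<in> A" "C t \<in> fst c"
begin

text \<open>A point of the curve and a chart around it are fixed; \<open>f\<close>, \<open>B\<close>, \<open>\<xi>'\<close>, \<open>v\<close> and \<open>z\<close> are the
  endomorphism, the metric, the Reeb vector, the velocity and the acceleration there, in coordinates.\<close>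
abbreviation (input) f where "f x \<equiv> \<phi> (C t) (of_coords A c (C t) x) c"
abbreviation (input) B where "B x y \<equiv> g (C t) (of_coords A c (C t) x) (of_coords A c (C t) y)"
abbreviation (input) \<xi>' where "\<xi>' \<equiv> \<xi> (C t) c"
abbreviation (input) v where "v \<equiv> V t c"
abbreviation (input) z where "z \<equiv> nabla_along A g I C V t c"

interpretation contact: almost_contact_B_space f "\<xi>'" "\<lambda>x. \<eta> (C t) (of_coords A c (C t) x)" B
  by (rule almost_contact_B_space_in_chart[OF c])

lemma point_in_topspace: "C t \<in> topspace M" using curve_in_topspace[OF t] .

lemma coords:
  "of_coords A c (C t) v = V t" "of_coords A c (C t) \<xi>' = \<xi> (C t)"
  "of_coords A c (C t) (\<phi> (C t) (V t) c) = \<phi> (C t) (V t)"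
  by (simp_all add: of_coords_component[OF c] velocity_in_tangent_space[OF t] \<xi>_in_tangent_space[OF point_in_topspace]
      \<phi>_in_tangent_space[OF point_in_topspace])

lemma velocity_in_chart:
  shows "v \<noteq> 0" "B v v = 0" "\<eta> (C t) (of_coords A c (C t) v) = a" "B v (f v) = b t"
proof -
  show "v \<noteq> 0"
  proof
    assume "v = 0"
    then have "V t = of_coords A c (C t) 0" using coords(1) by simp
    also have "\<dots> = 0" using linear_of_coords(2)[OF c, of 0 0] by simp
    finally show False using velocity_null(2)[OF t] by simp
  qed
qed (simp_all add: coords velocity_null[OF t] b_def)

lemma metric_derivative_in_chart:
  assumes "differentiable_field c t X" "differentiable_field c t Y"
  shows "((\<lambda>s. g (C s) (X s) (Y s)) has_vector_derivative
    B (nabla_along A g I C X t c) (Y t c) + B (X t c) (nabla_along A g I C Y t c)) (at t within I)"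
  using metric_derivative_along[OF t c assms] by (simp add: inner_metric_comps[OF c])

lemmas V_diff = differentiable_field_velocity[OF t c]
lemmas \<xi>_diff = differentiable_field_restriction[OF t c smooth_\<xi>]
lemmas \<phi>V_diff = endomorphism_derivative_along(1)[OF t c V_diff smooth_\<phi>]

text \<open>The Sasaki-like condition with both arguments equal to the null velocity; the term with \<open>g(V, V)\<close>
  vanishes.\<close>
lemma nabla_\<phi>_velocity:
  "nabla_along A g I C (\<lambda>s. \<phi> (C s) (V s)) t c = - a *\<^sub>R v + (2 * a\<^sup>2) *\<^sub>R \<xi>' + f z"
proof -
  have "nabla_endo A g \<phi> (C t) (V t) (V t) = - (0 *\<^sub>R \<xi> (C t)) - a *\<^sub>R V t + (2 * a * a) *\<^sub>R \<xi> (C t)"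
    using sasaki point_in_topspace velocity_in_tangent_space[OF t] velocity_null[OF t] by (simp add: sasaki_like_def)
  then show ?thesis
    using endomorphism_derivative_along(2)[OF t c V_diff smooth_\<phi>]
    by (simp add: endo_comps_mult[OF smooth_\<phi> c] power2_eq_square)
qed

text \<open>Differentiating \<open>\<phi> \<xi> = 0\<close> along the curve expresses \<open>\<phi> (\<nabla>\<xi>)\<close> by the Sasaki-like condition.  As \<open>\<nabla>\<xi>\<close> is
  orthogonal to \<open>\<xi>\<close>, this amounts to \<open>\<nabla>\<xi> = - \<phi> V\<close>.\<close>
lemma f_nabla_\<xi>: "f (nabla_along A g I C (\<lambda>s. \<xi> (C s)) t c) = v - a *\<^sub>R \<xi>'"
proof -
  let ?X = "\<lambda>s. \<xi> (C s)"
  have \<eta>\<xi>: "\<eta> (C t) (\<xi> (C t)) = 1"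
    using contact.\<eta>_\<xi> by (simp add: coords)
  have "g (C t) (V t) (\<xi> (C t)) = a"
    using metric_\<xi>[OF point_in_topspace velocity_in_tangent_space[OF t]]
      metric_symmetric[OF point_in_topspace velocity_in_tangent_space[OF t] \<xi>_in_tangent_space[OF point_in_topspace]] velocity_null[OF t] by simp
  then have "nabla_endo A g \<phi> (C t) (V t) (\<xi> (C t)) = - (a *\<^sub>R \<xi> (C t)) - 1 *\<^sub>R V t + (2 * a * 1) *\<^sub>R \<xi> (C t)"
    using sasaki point_in_topspace velocity_in_tangent_space[OF t] \<xi>_in_tangent_space[OF point_in_topspace] velocity_null[OF t] \<eta>\<xi>
    by (simp add: sasaki_like_def)
  then have 1: "nabla_along A g I C (\<lambda>s. \<phi> (C s) (?X s)) t c = a *\<^sub>R \<xi>' - v + f (nabla_along A g I C ?X t c)"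
    using endomorphism_derivative_along(2)[OF t c \<xi>_diff smooth_\<phi>]
    by (simp add: endo_comps_mult[OF smooth_\<phi> c] scaleR_2 flip: scaleR_scaleR)
  have "vector_derivative (\<lambda>s. \<phi> (C s) (?X s) c) (at t within I) = 0"
    using constant_has_zero_derivative[OF t differentiable_fieldD(2)[OF endomorphism_derivative_along(1)[OF t c \<xi>_diff smooth_\<phi>]], of 0]
    by (simp add: \<phi>_\<xi> curve_in_topspace)
  then have "nabla_along A g I C (\<lambda>s. \<phi> (C s) (?X s)) t c = 0"
    using c by (simp add: nabla_along_def at_charts_def \<phi>_\<xi>[OF point_in_topspace] christoffel_map_def vec_eq_iff)
  with 1 show ?thesis by (simp add: algebra_simps eq_neg_iff_add_eq_0)
qed

text \<open>The derivative of \<open>g(V, V) = 0\<close>.\<close>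
lemma acceleration_velocity: "B z v = 0"
  using constant_has_zero_derivative[OF t metric_derivative_in_chart[OF V_diff V_diff], of 0]
    contact.g_sym[of z v] by (simp add: velocity_null)

text \<open>The derivative of \<open>g(\<xi>, V) = a\<close> gives \<open>g(\<nabla>V, \<xi>) = - g(V, \<nabla>\<xi>)\<close>, and the right-hand side is
  \<open>g(\<phi> V, \<phi> (\<nabla>\<xi>))\<close> by the B-metric identity, since \<open>\<eta>(\<nabla>\<xi>) = 0\<close> by the constancy of \<open>g(\<xi>, \<xi>)\<close>.\<close>
lemma acceleration_\<xi>: "B z \<xi>' = b t"
proof -
  let ?X = "\<lambda>s. \<xi> (C s)"
  let ?n = "nabla_along A g I C ?X t c"
  have "B ?n \<xi>' + B \<xi>' ?n = 0"
    by (rule constant_has_zero_derivative[OF t metric_derivative_in_chart[OF \<xi>_diff \<xi>_diff], of 1])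
       (use almost_contact in \<open>auto simp: metric_\<xi> curve_in_topspace \<xi>_in_tangent_space almost_contact_B_metric_3_manifold_def\<close>)
  then have n: "\<eta> (C t) (of_coords A c (C t) ?n) = 0"
    by (simp only: contact.g_\<xi> contact.g_\<xi>_right)
  have "B ?n v + B \<xi>' z = 0"
    by (rule constant_has_zero_derivative[OF t metric_derivative_in_chart[OF \<xi>_diff V_diff], of a])
       (simp add: metric_\<xi> curve_in_topspace velocity_in_tangent_space velocity_null)
  then have "B z \<xi>' = - B v ?n" using contact.g_sym[of z "\<xi>'"] contact.g_sym[of v ?n] by simp
  also have "\<dots> = B (f v) (f ?n)" using contact.g_f_f[of v ?n] n by simp
  also have "\<dots> = B (f v) v - a * B (f v) \<xi>'"
    by (simp only: f_nabla_\<xi> bilinear_rsub[OF contact.bilinear_g] bilinear_rmul[OF contact.bilinear_g] real_scaleR_def)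
  also have "\<dots> = b t"
    by (simp only: contact.g_\<xi>_right contact.\<eta>_f contact.g_f_left velocity_in_chart mult_zero_right diff_zero)
  finally show ?thesis .
qed

text \<open>Self-adjointness of \<open>\<phi>\<close> makes the two acceleration terms in the derivative of \<open>g(V, \<phi> V)\<close> equal.\<close>
lemma b_has_derivative:
  "(b has_vector_derivative 2 * B z (f v) + 2 * a ^ 3) (at t within I)"
proof -
  have fv: "f v = \<phi> (C t) (V t) c" by (simp add: coords)
  have "B v (- a *\<^sub>R v + (2 * a\<^sup>2) *\<^sub>R \<xi>' + f z) = - a * B v v + (2 * a\<^sup>2) * B v \<xi>' + B v (f z)"
    by (simp only: bilinear_radd[OF contact.bilinear_g] bilinear_rmul[OF contact.bilinear_g] real_scaleR_def)
  also have "\<dots> = 2 * a ^ 3 + B v (f z)"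
    by (simp only: contact.g_\<xi>_right velocity_in_chart) (simp add: power2_eq_square power3_eq_cube)
  also have "B v (f z) = B z (f v)"
    by (simp only: contact.g_f_left[symmetric] contact.g_sym[of "f v"])
  finally have "B v (nabla_along A g I C (\<lambda>s. \<phi> (C s) (V s)) t c) = 2 * a ^ 3 + B z (f v)"
    by (simp only: nabla_\<phi>_velocity)
  with metric_derivative_in_chart[OF V_diff \<phi>V_diff]
  show ?thesis unfolding b_def[abs_def] fv by (simp add: algebra_simps)
qed

lemma acceleration_in_chart:
  assumes b': "b' = vector_derivative b (at t within I)"
  shows "z = (- b t * (- 2 * D t + a * b') / (2 * D t)) *\<^sub>R \<xi>' + (b t * b' / (2 * D t)) *\<^sub>R v
           + (a * (- 2 * D t + a * b') / (2 * D t)) *\<^sub>R f v"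
proof (rule contact.vector_determined_by_frame_products[OF velocity_in_chart(1,2)])
  have "b' = 2 * B z (f v) + 2 * a ^ 3"
    using vector_derivative_within[OF at_within_param_nontrivial[OF t] b_has_derivative] by (simp add: b')
  then show "B z (f v) = b' / 2 - a ^ 3" by (simp add: add_divide_distrib)
qed (use velocity_in_chart acceleration_velocity acceleration_\<xi> in \<open>simp_all add: D_def\<close>)

lemma D_pos_in_chart: "D t > 0"
  using contact.null_vector_discriminant_pos[OF velocity_in_chart(1,2)]
  by (simp add: velocity_in_chart D_def)

lemma unit_normal_in_chart:
  assumes W: "W \<in> tangent_space A (C t)" "g (C t) (V t) W = 0" "g (C t) W W = 1"
    and m: "m = (- b t * g (C t) W (\<xi> (C t)) + a * g (C t) W (\<phi> (C t) (V t))) / D t"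
  shows "m\<^sup>2 * D t = 1"
    "\<exists>q. W = m *\<^sub>R (- b t *\<^sub>R \<xi> (C t) + a *\<^sub>R \<phi> (C t) (V t)) + q *\<^sub>R V t"
proof -
  have W': "of_coords A c (C t) (W c) = W" by (rule of_coords_component[OF c W(1)])
  have m': "m = (- b t * B (W c) \<xi>' + a * B (W c) (f v)) / D t"
    by (simp add: m coords W')
  note n = contact.unit_normal_of_null_vector[OF velocity_in_chart(1,2) velocity_in_chart(3)[symmetric]
      velocity_in_chart(4)[symmetric] D_def _ _ m']
  show "m\<^sup>2 * D t = 1" by (rule n(1)) (simp_all add: coords W' W)
  obtain q where q: "W c = m *\<^sub>R (- b t *\<^sub>R \<xi>' + a *\<^sub>R f v) + q *\<^sub>R v"
    using n(2) by (auto simp: coords W' W)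
  have "W = m *\<^sub>R (- b t *\<^sub>R \<xi> (C t) + a *\<^sub>R \<phi> (C t) (V t)) + q *\<^sub>R V t"
  proof (rule tangent_vector_eqI[OF c W(1)])
    show "m *\<^sub>R (- b t *\<^sub>R \<xi> (C t) + a *\<^sub>R \<phi> (C t) (V t)) + q *\<^sub>R V t \<in> tangent_space A (C t)"
      by (intro tangent_space_add[OF point_in_topspace] tangent_space_scaleR[OF point_in_topspace] \<xi>_in_tangent_space[OF point_in_topspace]
          \<phi>_in_tangent_space[OF point_in_topspace] velocity_in_tangent_space[OF t])
  qed (simp add: q coords)
  then show "\<exists>q. W = m *\<^sub>R (- b t *\<^sub>R \<xi> (C t) + a *\<^sub>R \<phi> (C t) (V t)) + q *\<^sub>R V t" by blast
qed

lemma continuous_metric_products: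
  assumes "differentiable_field c t W"
  shows "continuous (at t within I) (\<lambda>s. g (C s) (W s) (\<xi> (C s)))"
    "continuous (at t within I) (\<lambda>s. g (C s) (W s) (\<phi> (C s) (V s)))"
    "continuous (at t within I) b"
  using metric_derivative_in_chart[OF assms \<xi>_diff] metric_derivative_in_chart[OF assms \<phi>V_diff]
    b_has_derivative has_vector_derivative_continuous by blast+

end

lemma chart_at: "t \<in> I \<Longrightarrow> \<exists>c. c \<in> A \<and> C t \<in> fst c"
  using chart_exists curve_in_topspace by blast

lemma D_pos: "t \<in> I \<Longrightarrow> D t > 0"
  using D_pos_in_chart chart_at by blast

text \<open>Both sides vanish in the charts that do not contain the point, so the comparison in single charts
  suffices.\<close>
lemma acceleration_formula:
  assumes t: "t \<in> I" and b': "b' = vector_derivative b (at t within I)"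
  shows "nabla_along A g I C V t =
    (- b t * (- 2 * D t + a * b') / (2 * D t)) *\<^sub>R \<xi> (C t) + (b t * b' / (2 * D t)) *\<^sub>R V t
    + (a * (- 2 * D t + a * b') / (2 * D t)) *\<^sub>R \<phi> (C t) (V t)" (is "_ = ?R")
proof
  fix c
  have p: "C t \<in> topspace M" using curve_in_topspace[OF t] .
  show "nabla_along A g I C V t c = ?R c"
  proof (cases "c \<in> A \<and> C t \<in> fst c")
    case True
    then have c: "c \<in> A" "C t \<in> fst c" by auto
    show ?thesis by (subst acceleration_in_chart[OF t c b']) (simp add: coords[OF t c])
  next
    case False
    have "?R \<in> tangent_space A (C t)"
      by (intro tangent_space_add[OF p] tangent_space_scaleR[OF p] \<xi>_in_tangent_space[OF p]
          \<phi>_in_tangent_space[OF p] velocity_in_tangent_space[OF t])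
    then have "at_charts A (C t) ?R = ?R" unfolding tangent_space_def by blast
    from fun_cong[OF this, of c] False have "?R c = 0" by (simp only: at_charts_def if_False)
    moreover have "nabla_along A g I C V t c = 0" using False by (simp only: nabla_along_def at_charts_def if_False)
    ultimately show ?thesis by simp
  qed
qed

text \<open>The acceleration differs from a multiple of \<open>E = - b \<xi> + a \<phi> V\<close> by a multiple of the velocity, and \<open>W\<close>
  differs from \<open>m E\<close> by such a multiple, with \<open>m = \<plusminus> 1 / sqrt D\<close>.  The sign \<open>\<epsilon>\<close> of \<open>m\<close> does not depend on the
  parameter, because it is a continuous function on an interval.\<close>
lemma frenet_curvature:
  assumes frame: "frenet_frame A g I C N W"
  shows "\<exists>\<epsilon>\<in>{1, - 1}. \<forall>t\<in>I. frenet_k1 A g I C W t =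
    \<epsilon> * ((- 2 * D t + a * vector_derivative b (at t within I)) / (2 * sqrt (D t)))"
proof -
  define m where "m t = (- b t * g (C t) (W t) (\<xi> (C t)) + a * g (C t) (W t) (\<phi> (C t) (V t))) / D t" for t
  define \<epsilon> where "\<epsilon> t = m t * sqrt (D t)" for t
  have W: "smooth_field_along A I C W"
    "\<And>t. t \<in> I \<Longrightarrow> W t \<in> tangent_space A (C t)" "\<And>t. t \<in> I \<Longrightarrow> g (C t) (V t) (W t) = 0"
    "\<And>t. t \<in> I \<Longrightarrow> g (C t) (W t) (W t) = 1"
    using frame by (auto simp: frenet_frame_def smooth_field_along_def)
  have m: "(m t)\<^sup>2 * D t = 1"
      "\<exists>q. W t = m t *\<^sub>R (- b t *\<^sub>R \<xi> (C t) + a *\<^sub>R \<phi> (C t) (V t)) + q *\<^sub>R V t" if t: "t \<in> I" for t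
  proof -
    obtain c where c: "c \<in> A" "C t \<in> fst c" using chart_at[OF t] by blast
    show "(m t)\<^sup>2 * D t = 1"
      "\<exists>q. W t = m t *\<^sub>R (- b t *\<^sub>R \<xi> (C t) + a *\<^sub>R \<phi> (C t) (V t)) + q *\<^sub>R V t"
      using unit_normal_in_chart[OF t c W(2-4)[OF t] m_def] by blast+
  qed
  have range: "\<epsilon> t \<in> {1, - 1}" if t: "t \<in> I" for t
  proof -
    have "(\<epsilon> t)\<^sup>2 = 1" using m(1)[OF t] D_pos[OF t] by (simp add: \<epsilon>_def power_mult_distrib)
    then show ?thesis by (simp add: power2_eq_1_iff)
  qed
  have "continuous_on I \<epsilon>"
    unfolding continuous_on_eq_continuous_within
  proof
    fix t assume t: "t \<in> I"
    obtain c where c: "c \<in> A" "C t \<in> fst c" using chart_at[OF t] by blast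
    note cont = continuous_metric_products[OF t c differentiable_field_smooth[OF t c W(1)]]
    have D: "continuous (at t within I) D"
      unfolding D_def[abs_def] by (intro continuous_intros cont(3))
    show "continuous (at t within I) \<epsilon>"
      unfolding \<epsilon>_def[abs_def] m_def
      by (intro continuous_intros cont D) (use D_pos[OF t] in auto)
  qed
  moreover have "connected I" using curve by (simp add: smooth_curve_def is_interval_connected)
  moreover have "finite (\<epsilon> ` I)" by (rule finite_subset[of _ "{1, - 1}"]) (use range in auto)
  ultimately have "\<epsilon> constant_on I" using continuous_finite_range_constant_eq[THEN iffD1] by blast
  then obtain e where e: "\<And>t. t \<in> I \<Longrightarrow> \<epsilon> t = e" unfolding constant_on_def by blast
  have "I \<noteq> {}" using curve by (auto simp: smooth_curve_def)
  then obtain t where "t \<in> I" by blast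
  then have "e \<in> {1, - 1}" using e range by metis
  moreover have "frenet_k1 A g I C W t = e * ((- 2 * D t + a * vector_derivative b (at t within I)) / (2 * sqrt (D t)))"
    if t: "t \<in> I" for t
  proof -
    define b' where "b' = vector_derivative b (at t within I)"
    define K where "K = (- 2 * D t + a * b') / (2 * D t)"
    define E where "E = - b t *\<^sub>R \<xi> (C t) + a *\<^sub>R \<phi> (C t) (V t)"
    have p: "C t \<in> topspace M" using curve_in_topspace[OF t] .
    note VT = velocity_in_tangent_space[OF t] and WT = W(2)[OF t]
    obtain q where q: "W t = m t *\<^sub>R E + q *\<^sub>R V t" using m(2)[OF t] by (auto simp: E_def)
    have mm: "m t * D t * m t = 1" using m(1)[OF t] by (simp add: power2_eq_square mult_ac)
    have "(m t * D t) *\<^sub>R W t = E + (m t * D t * q) *\<^sub>R V t"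
      by (simp only: q scaleR_add_right scaleR_scaleR mm scaleR_one)
    then have E: "E = (m t * D t) *\<^sub>R W t - (m t * D t * q) *\<^sub>R V t" by simp
    have "nabla_along A g I C V t = (b t * b' / (2 * D t)) *\<^sub>R V t + K *\<^sub>R E"
      by (simp add: acceleration_formula[OF t b'_def] K_def E_def scaleR_add_right scaleR_diff_right mult.commute)
    also have "\<dots> = (b t * b' / (2 * D t) - K * (m t * D t * q)) *\<^sub>R V t + (K * (m t * D t)) *\<^sub>R W t"
      by (simp add: E algebra_simps)
    finally have z: "nabla_along A g I C V t =
      (b t * b' / (2 * D t) - K * (m t * D t * q)) *\<^sub>R V t + (K * (m t * D t)) *\<^sub>R W t" .
    \<comment> \<open>The product with \<open>W t\<close> reads off the curvature, which makes it unique.\<close>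
    have k: "g (C t) (W t) (h *\<^sub>R V t + k *\<^sub>R W t) = k" for h k
      using metric_add[OF p WT tangent_space_scaleR[OF p VT] tangent_space_scaleR[OF p WT], of h k]
        metric_scaleR[OF p WT VT, of h] metric_scaleR[OF p WT WT, of k] W(3,4)[OF t] metric_symmetric[OF p WT VT]
      by simp
    have "frenet_k1 A g I C W t = K * (m t * D t)"
      unfolding frenet_k1_def
    proof (rule the_equality)
      show "\<exists>h. nabla_along A g I C V t = h *\<^sub>R V t + (K * (m t * D t)) *\<^sub>R W t" using z by blast
      show "k = K * (m t * D t)" if "\<exists>h. nabla_along A g I C V t = h *\<^sub>R V t + k *\<^sub>R W t" for k
        using that z k by metis
    qed
    also have "\<dots> = (m t * sqrt (D t)) * ((- 2 * D t + a * b') / (2 * sqrt (D t)))"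
      using D_pos[OF t] by (simp add: K_def)
    also have "m t * sqrt (D t) = e" using e[OF t] by (simp only: \<epsilon>_def)
    finally show ?thesis by (simp only: b'_def)
  qed
  ultimately show ?thesis by blast
qed

end
theorem proposition3p5:
  fixes M :: "'m topology" and A :: "'m chart set"
    and \<phi> :: "'m \<Rightarrow> 'm tvec \<Rightarrow> 'm tvec" and \<xi> :: "'m \<Rightarrow> 'm tvec"
    and \<eta> :: "'m \<Rightarrow> 'm tvec \<Rightarrow> real" and g :: "'m \<Rightarrow> 'm tvec \<Rightarrow> 'm tvec \<Rightarrow> real"
    and I :: "real set" and C :: "real \<Rightarrow> 'm"
    and a :: real and b b' \<alpha> \<beta> \<gamma> :: "real \<Rightarrow> real"
  assumes "almost_contact_B_metric_3_manifold M A \<phi> \<xi> \<eta> g"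
    and "sasaki_like M A \<phi> \<xi> \<eta> g"
    and "null_curve M A g I C"
    and "slant A \<eta> I C a"
    and b: "\<And>t. b t = g (C t) (velocity A I C t) (\<phi> (C t) (velocity A I C t))"
    and b': "\<And>t. b' t = vector_derivative b (at t within I)"
    and \<alpha>: "\<And>t. \<alpha> t = (- b t * (- 2 * (a ^ 4 + (b t)\<^sup>2) + a * b' t)) / (2 * (a ^ 4 + (b t)\<^sup>2))"
    and \<beta>: "\<And>t. \<beta> t = (b t * b' t) / (2 * (a ^ 4 + (b t)\<^sup>2))"
    and \<gamma>: "\<And>t. \<gamma> t = (a * (- 2 * (a ^ 4 + (b t)\<^sup>2) + a * b' t)) / (2 * (a ^ 4 + (b t)\<^sup>2))"
  shows "(\<forall>t\<in>I. nabla_along A g I C (velocity A I C) t =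
             \<alpha> t *\<^sub>R \<xi> (C t) + \<beta> t *\<^sub>R velocity A I C t
             + \<gamma> t *\<^sub>R \<phi> (C t) (velocity A I C t)) \<and>
         (\<forall>N W. frenet_frame A g I C N W \<longrightarrow>
            (\<exists>\<epsilon>\<in>{1, - 1}. \<forall>t\<in>I. frenet_k1 A g I C W t =
               \<epsilon> * ((- 2 * (a ^ 4 + (b t)\<^sup>2) + a * b' t) / (2 * sqrt (a ^ 4 + (b t)\<^sup>2)))))"
proof -
  interpret curve: slant_null_curve M A \<phi> \<xi> \<eta> g I C a
    using assms(1-4) by unfold_locales
  have b_eq: "b = curve.b" by (simp add: fun_eq_iff b curve.b_def)
  have b'_eq: "b' t = vector_derivative curve.b (at t within I)" for t
    by (simp add: b' b_eq)
  have D_eq: "a ^ 4 + (curve.b t)\<^sup>2 = curve.D t" for t by (simp add: curve.D_def)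
  have "nabla_along A g I C (velocity A I C) t =
      \<alpha> t *\<^sub>R \<xi> (C t) + \<beta> t *\<^sub>R velocity A I C t + \<gamma> t *\<^sub>R \<phi> (C t) (velocity A I C t)" if "t \<in> I" for t
    using curve.acceleration_formula[OF that b'_eq] unfolding \<alpha> \<beta> \<gamma> D_eq b_eq .
  moreover have "\<exists>\<epsilon>\<in>{1, - 1}. \<forall>t\<in>I. frenet_k1 A g I C W t =
      \<epsilon> * ((- 2 * (a ^ 4 + (b t)\<^sup>2) + a * b' t) / (2 * sqrt (a ^ 4 + (b t)\<^sup>2)))"
    if "frenet_frame A g I C N W" for N W
    using curve.frenet_curvature[OF that] unfolding b_eq D_eq b'_eq .
  ultimately show ?thesis by blast
qed

end
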